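(* Let $f(\tau)=|\tau|^\kappa$, $\tau\in\mathbb{R}$, with $\kappa>0$. There is $\omega_0<m$ and an open neighborhood $U\subset\mathbb{R}$ of $0$ such that for $\omega\in(\omega_0,m)$ and $\epsilon\in U\setminus\{0\}$ the point spectrum $\sigma_{\mathrm p}(\mathbf{A}(\epsilon))$ (of the operator $\mathbf{A}(\epsilon)$ defined in the context, which depends on $\omega$) contains eigenvalues $\pm\lambda(\epsilon)$ and $\pm\overline{\lambda(\epsilon)}$, with $$\lambda(\epsilon)=i(2\omega+\zeta(\epsilon)),\qquad\operatorname{Im}\zeta(\epsilon)<0\quad\forall\epsilon\in U\setminus\{0\},\qquad\lim_{\epsilon\to0}\zeta(\epsilon)=0.$$ That is, the solitary waves corresponding to $\omega\in(\omega_0,m)$ are spectrally unstable.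
   Context: Let $m>0$. Pauli matrices: $\sigma_1=\begin{bmatrix}0&1\\1&0\end{bmatrix}$, $\sigma_2=\begin{bmatrix}0&-i\\i&0\end{bmatrix}$, $\sigma_3=\begin{bmatrix}1&0\\0&-1\end{bmatrix}$; $I_2$ is the identity. $D_m=i\sigma_2\partial_x+m\sigma_3$. For $\omega\in(-m,m)$ put $\varkappa=\sqrt{m^2-\omega^2}$ and $\mu=\sqrt{\frac{m-\omega}{m+\omega}}$. For a vector function $\psi\in H^1(\mathbb{R}\setminus\{0\})$ write $\hat\psi=(\psi(0^+)+\psi(0^-))/2$, $[\psi]_0=\psi(0^+)-\psi(0^-)$. Consider the equation $i\partial_t\psi=D_m\psi-\delta(x)f(\psi^*(\sigma_3+\epsilon\sigma_1)\psi)(\sigma_3+\epsilon\sigma_1)\psi$, $\psi(t,x)\in\mathbb{C}^2$, understood with the jump condition $i\sigma_2[\psi]_0-f(\hat\psi^*(\sigma_3+\epsilon\sigma_1)\hat\psi)(\sigma_3+\epsilon\sigma_1)\hat\psi=0$. For $\omega<m$ close to $m$ and $|\epsilon|$ small, it has solitary waves $\varPhi_{\omega,\epsilon}(x)e^{-i\omega t}$ with $$\varPhi_{\omega,\epsilon}(x)=\left(\alpha\begin{bmatrix}1\\\mu\,\mathrm{sgn}\,x\end{bmatrix}+\beta\begin{bmatrix}\mathrm{sgn}\,x\\\mu\end{bmatrix}\right)e^{-\varkappa|x|},\qquad\alpha=\alpha(\omega,\epsilon)>0,\quad\beta=\beta(\omega,\epsilon)\in\mathbb{R},$$ where, with $\tau=\alpha^2+2\epsilon\alpha\beta\mu-\beta^2\mu^2$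 (which equals $\hat\varPhi_{\omega,\epsilon}^*(\sigma_3+\epsilon\sigma_1)\hat\varPhi_{\omega,\epsilon}$) and with $f$ denoting the value $f(\tau)=|\tau|^\kappa$, $$f=\frac{1+\mu^2-\sqrt{1-2\mu^2+\mu^4-4\mu^2\epsilon^2}}{(1+\epsilon^2)\mu},\qquad\beta=-\frac{f\epsilon\alpha}{2-f\mu}.$$ Let $g=f'(\tau)$ and $v=\begin{bmatrix}\alpha+\epsilon\beta\mu\\\epsilon\alpha-\beta\mu\end{bmatrix}=(\sigma_3+\epsilon\sigma_1)\hat\varPhi_{\omega,\epsilon}$. The linearization operator $\mathbf{A}(\epsilon)$ at this solitary wave (from $\psi=(\varPhi_{\omega,\epsilon}+r+is)e^{-i\omega t}$) is the unbounded operator in $L^2(\mathbb{R},\mathbb{C}^4)$ acting on $(r,s)$ as $\begin{bmatrix}0&D_m-\omega I_2\\-D_m+\omega I_2&0\end{bmatrix}$ on $\mathbb{R}\setminus\{0\}$, with domain consisting of $(r,s)\in H^1(\mathbb{R}\setminus\{0\},\mathbb{C}^2\times\mathbb{C}^2)$ such that $$i\sigma_2[r]_0-\big(f(\sigma_3+\epsilon\sigma_1)+2g\,vv^{T}\big)\hat r=0,\qquad i\sigma_2[s]_0-f(\sigma_3+\epsilon\sigma_1)\hat s=0.$$ A solitary wave is spectrally stable if the spectrum of the linearization operator has no points in the open right half-plane, and spectrally (linearly) unstable otherwise. *)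

theory Defs
  imports "HOL-Analysis.Analysis"
begin

section \<open>The spaces \<open>L\<^sup>2(\<real>)\<close> and \<open>H\<^sup>1(\<real> \<setminus> {0})\<close>\<close>

text \<open>Elements of \<open>L\<^sup>2\<close> are represented by functions; every notion below that takes such
  functions as arguments is invariant under changes on null sets.\<close>

definition L2 :: "(real \<Rightarrow> 'a::euclidean_space) set" where
  "L2 = {u. u \<in> borel_measurable lborel \<and> integrable lborel (\<lambda>x. (norm (u x))\<^sup>2)}"

definition L2_norm :: "(real \<Rightarrow> 'a::euclidean_space) \<Rightarrow> real" where
  "L2_norm u = sqrt (LINT x|lborel. (norm (u x))\<^sup>2)"

definition smooth :: "(real \<Rightarrow> real) \<Rightarrow> bool" where
  "smooth \<phi> \<longleftrightarrow> (\<exists>D :: nat \<Rightarrow> real \<Rightarrow> real. D 0 = \<phi> \<and>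
     (\<forall>n x. (D n has_real_derivative D (Suc n) x) (at x)))"

definition test_function :: "(real \<Rightarrow> real) \<Rightarrow> bool" where
  "test_function \<phi> \<longleftrightarrow> smooth \<phi> \<and> compact (closure {x. \<phi> x \<noteq> 0}) \<and>
     closure {x. \<phi> x \<noteq> 0} \<subseteq> - {0}"

text \<open>The distributional derivative on \<open>\<real> \<setminus> {0}\<close>: it does not see a jump at \<open>0\<close>.\<close>

definition weak_deriv :: "(real \<Rightarrow> 'a::euclidean_space) \<Rightarrow> (real \<Rightarrow> 'a) \<Rightarrow> bool" where
  "weak_deriv u d \<longleftrightarrow> (\<forall>\<phi>. test_function \<phi> \<longrightarrow>
     (LINT x|lborel. deriv \<phi> x *\<^sub>R u x) = - (LINT x|lborel. \<phi> x *\<^sub>R d x))"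

text \<open>\<open>d\<close> is a weak derivative witnessing \<open>u \<in> H\<^sup>1(\<real> \<setminus> {0})\<close>.\<close>

definition H1_deriv :: "(real \<Rightarrow> 'a::euclidean_space) \<Rightarrow> (real \<Rightarrow> 'a) \<Rightarrow> bool" where
  "H1_deriv u d \<longleftrightarrow> u \<in> L2 \<and> d \<in> L2 \<and> weak_deriv u d"

text \<open>One-sided traces at \<open>0\<close> (\<open>F\<close> is \<open>at_right 0\<close> or \<open>at_left 0\<close>): the limit of the continuous
  representative, which exists and is unique for \<open>u \<in> H\<^sup>1(\<real> \<setminus> {0})\<close>.\<close>

definition trace0 :: "real filter \<Rightarrow> (real \<Rightarrow> 'a::euclidean_space) \<Rightarrow> 'a" where
  "trace0 F u = (THE c. \<exists>w. continuous_on (- {0}) w \<and> (AE x in lborel. w x = u x) \<and> (w \<longlongrightarrow> c) F)"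

definition jump0 :: "(real \<Rightarrow> 'a::euclidean_space) \<Rightarrow> 'a" where
  "jump0 u = trace0 (at_right 0) u - trace0 (at_left 0) u"

definition mean0 :: "(real \<Rightarrow> 'a::euclidean_space) \<Rightarrow> 'a" where
  "mean0 u = (1/2) *\<^sub>R (trace0 (at_right 0) u + trace0 (at_left 0) u)"


section \<open>Spectra of unbounded operators in \<open>L\<^sup>2(\<real>, \<complex>\<^sup>2 \<times> \<complex>\<^sup>2)\<close>\<close>

type_synonym spinor = "complex ^ 2"

definition cscale :: "complex \<Rightarrow> spinor \<times> spinor \<Rightarrow> spinor \<times> spinor" where
  "cscale c p = (c *s fst p, c *s snd p)"

text \<open>An unbounded operator \<open>A\<close> is given by its graph: \<open>A u h\<close> means that \<open>u\<close> is in the domain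
  of \<open>A\<close> and \<open>A u = h\<close> almost everywhere.\<close>

type_synonym operator =
  "(real \<Rightarrow> spinor \<times> spinor) \<Rightarrow> (real \<Rightarrow> spinor \<times> spinor) \<Rightarrow> bool"

definition point_spectrum :: "operator \<Rightarrow> complex set" where
  "point_spectrum A = {z. \<exists>u\<in>L2. \<not> (AE x in lborel. u x = 0) \<and> A u (\<lambda>x. cscale z (u x))}"

text \<open>\<open>z\<close> is in the resolvent set iff \<open>A - z\<close> maps its domain onto \<open>L\<^sup>2\<close> and has a bounded inverse;
  the norm bound includes injectivity.\<close>

definition resolvent_set :: "operator \<Rightarrow> complex set" where
  "resolvent_set A = {z.
     (\<forall>h\<in>L2. \<exists>u\<in>L2. A u (\<lambda>x. h x + cscale z (u x))) \<and>
     (\<exists>C. \<forall>u\<in>L2. \<forall>h\<in>L2. A u (\<lambda>x. h x + cscale z (u x)) \<longrightarrow> L2_norm u \<le> C * L2_norm h)}"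

definition spectrum :: "operator \<Rightarrow> complex set" where
  "spectrum A = - resolvent_set A"

definition spectrally_stable :: "operator \<Rightarrow> bool" where
  "spectrally_stable A \<longleftrightarrow> spectrum A \<inter> {z. Re z > 0} = {}"


section \<open>The Dirac equation with concentrated nonlinearity\<close>

definition sigma1 :: "complex ^ 2 ^ 2" where
  "sigma1 = vector [vector [0, 1], vector [1, 0]]"

definition sigma2 :: "complex ^ 2 ^ 2" where
  "sigma2 = vector [vector [0, - \<i>], vector [\<i>, 0]]"

definition sigma3 :: "complex ^ 2 ^ 2" where
  "sigma3 = vector [vector [1, 0], vector [0, - 1]]"

definition coupling :: "real \<Rightarrow> complex ^ 2 ^ 2" where
  "coupling \<epsilon> = sigma3 + \<epsilon> *\<^sub>R sigma1"

definition nonlin :: "real \<Rightarrow> real \<Rightarrow> real" where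
  "nonlin \<kappa> t = \<bar>t\<bar> powr \<kappa>"

text \<open>\<open>D\<^sub>m u = i \<sigma>\<^sub>2 u' + m \<sigma>\<^sub>3 u\<close>, with the derivative \<open>d = u'\<close> passed explicitly.\<close>

definition dirac :: "real \<Rightarrow> (real \<Rightarrow> spinor) \<Rightarrow> (real \<Rightarrow> spinor) \<Rightarrow> real \<Rightarrow> spinor" where
  "dirac m u d x = \<i> *s (sigma2 *v d x) + m *\<^sub>R (sigma3 *v u x)"

text \<open>The quadratic form \<open>z\<^sup>* (\<sigma>\<^sub>3 + \<epsilon> \<sigma>\<^sub>1) z\<close>; it is real because the matrix is Hermitian.\<close>

definition coupling_form :: "real \<Rightarrow> spinor \<Rightarrow> real" where
  "coupling_form \<epsilon> z = Re (\<Sum>i\<in>UNIV. cnj (z $ i) * (coupling \<epsilon> *v z) $ i)"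

definition nld_solution :: "real \<Rightarrow> real \<Rightarrow> real \<Rightarrow> (real \<Rightarrow> real \<Rightarrow> spinor) \<Rightarrow> bool" where
  "nld_solution m \<kappa> \<epsilon> \<psi> \<longleftrightarrow> (\<forall>t.
     (\<exists>d. H1_deriv (\<psi> t) d \<and>
        (AE x in lborel. \<exists>p. ((\<lambda>s. \<psi> s x) has_vector_derivative p) (at t) \<and>
           \<i> *s p = dirac m (\<psi> t) d x)) \<and>
     \<i> *s (sigma2 *v jump0 (\<psi> t))
       - nonlin \<kappa> (coupling_form \<epsilon> (mean0 (\<psi> t))) *\<^sub>R (coupling \<epsilon> *v mean0 (\<psi> t)) = 0)"


section \<open>Solitary waves\<close>

definition varkappa :: "real \<Rightarrow> real \<Rightarrow> real" where
  "varkappa m \<omega> = sqrt (m\<^sup>2 - \<omega>\<^sup>2)"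

definition mu :: "real \<Rightarrow> real \<Rightarrow> real" where
  "mu m \<omega> = sqrt ((m - \<omega>) / (m + \<omega>))"

definition profile :: "real \<Rightarrow> real \<Rightarrow> real \<Rightarrow> real \<Rightarrow> real \<Rightarrow> spinor" where
  "profile m \<omega> \<alpha> \<beta> x = exp (- varkappa m \<omega> * \<bar>x\<bar>) *\<^sub>R
     (\<alpha> *\<^sub>R vector [1, of_real (mu m \<omega> * sgn x)] + \<beta> *\<^sub>R vector [of_real (sgn x), of_real (mu m \<omega>)])"

definition solitary_wave :: "real \<Rightarrow> real \<Rightarrow> real \<Rightarrow> real \<Rightarrow> (real \<Rightarrow> spinor) \<Rightarrow> bool" where
  "solitary_wave m \<kappa> \<epsilon> \<omega> \<Phi> \<longleftrightarrow>
     nld_solution m \<kappa> \<epsilon> (\<lambda>t x. exp (- (\<i> * of_real (\<omega> * t))) *s \<Phi> x)"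

definition tau :: "real \<Rightarrow> real \<Rightarrow> real \<Rightarrow> real \<Rightarrow> real \<Rightarrow> real" where
  "tau m \<omega> \<epsilon> \<alpha> \<beta> = \<alpha>\<^sup>2 + 2 * \<epsilon> * \<alpha> * \<beta> * mu m \<omega> - \<beta>\<^sup>2 * (mu m \<omega>)\<^sup>2"

definition f_val :: "real \<Rightarrow> real \<Rightarrow> real \<Rightarrow> real" where
  "f_val m \<omega> \<epsilon> = (let \<mu> = mu m \<omega> in
     (1 + \<mu>\<^sup>2 - sqrt (1 - 2 * \<mu>\<^sup>2 + \<mu>^4 - 4 * \<mu>\<^sup>2 * \<epsilon>\<^sup>2)) / ((1 + \<epsilon>\<^sup>2) * \<mu>))"

text \<open>The conditions that determine \<open>\<alpha>(\<omega>, \<epsilon>)\<close> and \<open>\<beta>(\<omega>, \<epsilon>)\<close>.\<close>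

definition amplitudes :: "real \<Rightarrow> real \<Rightarrow> real \<Rightarrow> real \<Rightarrow> real \<Rightarrow> real \<Rightarrow> bool" where
  "amplitudes m \<kappa> \<omega> \<epsilon> \<alpha> \<beta> \<longleftrightarrow> \<alpha> > 0 \<and>
     nonlin \<kappa> (tau m \<omega> \<epsilon> \<alpha> \<beta>) = f_val m \<omega> \<epsilon> \<and>
     \<beta> = - (f_val m \<omega> \<epsilon> * \<epsilon> * \<alpha>) / (2 - f_val m \<omega> \<epsilon> * mu m \<omega>)"


section \<open>The linearization at a solitary wave\<close>

definition lin_vec :: "real \<Rightarrow> real \<Rightarrow> real \<Rightarrow> real \<Rightarrow> real \<Rightarrow> spinor" where
  "lin_vec m \<omega> \<epsilon> \<alpha> \<beta> =
     vector [of_real (\<alpha> + \<epsilon> * \<beta> * mu m \<omega>), of_real (\<epsilon> * \<alpha> - \<beta> * mu m \<omega>)]"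

text \<open>The operator \<open>A(\<epsilon>)\<close>. In the first jump condition, \<open>\<chi> i j. v $ i * v $ j\<close> is the matrix
  \<open>v v\<^sup>T\<close>.\<close>

definition linearization :: "real \<Rightarrow> real \<Rightarrow> real \<Rightarrow> real \<Rightarrow> real \<Rightarrow> real \<Rightarrow> operator" where
  "linearization m \<kappa> \<omega> \<epsilon> \<alpha> \<beta> u h \<longleftrightarrow>
     (let r = (\<lambda>x. fst (u x)); s = (\<lambda>x. snd (u x));
          \<tau> = tau m \<omega> \<epsilon> \<alpha> \<beta>; f = nonlin \<kappa> \<tau>; g = deriv (nonlin \<kappa>) \<tau>;
          v = lin_vec m \<omega> \<epsilon> \<alpha> \<beta>
      in h \<in> L2 \<and>
         (\<exists>dr ds. H1_deriv r dr \<and> H1_deriv s ds \<and>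
            (AE x in lborel. h x =
               (dirac m s ds x - \<omega> *\<^sub>R s x, - dirac m r dr x + \<omega> *\<^sub>R r x))) \<and>
         \<i> *s (sigma2 *v jump0 r)
           - (f *\<^sub>R coupling \<epsilon> + (2 * g) *\<^sub>R (\<chi> i j. v $ i * v $ j)) *v mean0 r = 0 \<and>
         \<i> *s (sigma2 *v jump0 s) - (f *\<^sub>R coupling \<epsilon>) *v mean0 s = 0)"

end

theory Submission
  imports Defs
begin

text \<open>Writing \<open>u = r + i s\<close>, \<open>w = r - i s\<close>, an eigenfunction for \<open>\<lambda> = i (2 \<omega> + \<zeta>)\<close> solves free Dirac
  equations on both half-lines, with energies \<open>-(\<omega> + \<zeta>)\<close> for \<open>u\<close> and \<open>3 \<omega> + \<zeta>\<close> for \<open>w\<close>; hence it is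
  an explicit exponential, and the jump conditions become a \<open>4 \<times> 4\<close> linear system. For \<open>\<epsilon> = 0\<close> the
  mode \<open>u\<close> exists with \<open>w = 0\<close> and \<open>\<zeta> = 0\<close>. For \<open>\<epsilon> \<noteq> 0\<close> it couples to \<open>w\<close>, whose energy lies in the
  continuous spectrum, so that the decay rate of \<open>w\<close> is almost purely imaginary. Eliminating all
  unknowns but the ratio \<open>N\<close> of the components of \<open>u\<close>, in units of \<open>\<mu>\<close>, leaves a fixed point equation
  \<open>N = F - \<epsilon>\<^sup>2 \<Psi>(N)\<close> with \<open>Im \<Psi> \<approx> - sqrt 2 \<kappa>\<^sup>2 \<mu>\<close>. Brouwer's theorem in the box
  \<open>\<bar>Re N - 1\<bar> \<le> \<delta>\<close>, \<open>0 \<le> Im N \<le> \<mu> \<delta>\<close> gives a solution with \<open>Im N > 0\<close>, which means \<open>Im \<zeta> < 0\<close>.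
  Scaling \<open>Im N\<close> by \<open>\<mu>\<close> makes the estimates uniform in \<open>\<omega>\<close> near \<open>m\<close>.\<close>

section \<open>Weak derivatives and traces\<close>

text \<open>The half-line function \<open>g\<close> plus its reflection dominates the integrand; at
  0 both contribute.\<close>

lemma integrable_exp_decay:
  fixes c :: real
  assumes "c > 0"
  shows "integrable lborel (\<lambda>x. exp (- c * \<bar>x\<bar>))"
proof -
  define g where "g = (\<lambda>x::real. indicator {0..} x *\<^sub>R exp (- c * x))"
  have "set_integrable lebesgue {0..} (\<lambda>x. exp (- c * x))"
    by (intro nonnegative_absolutely_integrable_1 integrable_on_exp_minus_to_infinity assms) auto
  then have g: "integrable lborel g"
    unfolding set_integrable_def g_def
    by (subst (asm) integrable_completion) auto
  have g': "integrable lborel (\<lambda>x. g (0 + (-1) * x))"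
    by (rule lborel_integrable_real_affine[OF g]) simp
  show ?thesis
    by (rule Bochner_Integration.integrable_bound[OF Bochner_Integration.integrable_add[OF g g']])
      (auto simp: g_def indicator_def)
qed

lemma L2_exp_decay:
  fixes u :: "real \<Rightarrow> 'a::euclidean_space"
  assumes u: "u \<in> borel_measurable borel" and c: "c > 0"
    and bound: "\<And>x. norm (u x) \<le> C * exp (- c * \<bar>x\<bar>)"
  shows "u \<in> L2"
proof -
  have "integrable lborel (\<lambda>x. C\<^sup>2 * exp (- (2 * c) * \<bar>x\<bar>))"
    using integrable_exp_decay[of "2 * c"] c by simp
  then have "integrable lborel (\<lambda>x. (norm (u x))\<^sup>2)"
  proof (rule Bochner_Integration.integrable_bound)
    show "(\<lambda>x. (norm (u x))\<^sup>2) \<in> borel_measurable lborel"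
      using u by measurable
    have "(norm (u x))\<^sup>2 \<le> C\<^sup>2 * exp (- (2 * c) * \<bar>x\<bar>)" for x
    proof -
      have "(norm (u x))\<^sup>2 \<le> (C * exp (- c * \<bar>x\<bar>))\<^sup>2"
        using bound by (intro power_mono) auto
      also have "\<dots> = C\<^sup>2 * exp (- (2 * c) * \<bar>x\<bar>)"
        by (simp add: power_mult_distrib flip: exp_double)
      finally show ?thesis .
    qed
    then show "AE x in lborel. norm ((norm (u x))\<^sup>2) \<le> norm (C\<^sup>2 * exp (- (2 * c) * \<bar>x\<bar>))"
      by simp
  qed
  then show ?thesis
    using u by (simp add: L2_def)
qed

text \<open>The description in \<open>trace0\<close> needs uniqueness: two representatives that are
  continuous off 0 and agree almost everywhere differ on an open null set. That set is empty, so
  they have the same limit along \<open>F\<close>.\<close>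

lemma trace0_eq:
  fixes u :: "real \<Rightarrow> 'a::euclidean_space"
  assumes F: "F \<noteq> bot" "F \<le> at 0" and cont: "continuous_on (- {0}) u" and lim: "(u \<longlongrightarrow> c) F"
  shows "trace0 F u = c"
  unfolding trace0_def
proof (rule the_equality)
  show "\<exists>w. continuous_on (- {0}) w \<and> (AE x in lborel. w x = u x) \<and> (w \<longlongrightarrow> c) F"
    using cont lim by auto
next
  fix c' assume "\<exists>w. continuous_on (- {0}) w \<and> (AE x in lborel. w x = u x) \<and> (w \<longlongrightarrow> c') F"
  then obtain w where w: "continuous_on (- {0}) w" "AE x in lborel. w x = u x" "(w \<longlongrightarrow> c') F"
    by blast
  define X where "X = - {0} \<inter> (\<lambda>x. w x - u x) -` (- {0})"
  have "open X"
    unfolding X_def by (auto intro!: continuous_open_preimage continuous_intros w cont)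
  moreover have "negligible X"
  proof -
    obtain N where N: "N \<in> null_sets lborel" "{x \<in> space lborel. w x \<noteq> u x} \<subseteq> N"
      using w(2) unfolding eventually_ae_filter by blast
    then have "negligible N"
      by (simp add: negligible_iff_null_sets null_sets_completionI)
    then show ?thesis
      by (rule negligible_subset) (use N(2) in \<open>auto simp: X_def\<close>)
  qed
  ultimately have "X = {}"
    using open_not_negligible by blast
  then have "w x = u x" if "x \<noteq> 0" for x
    using that by (auto simp: X_def)
  moreover have "eventually (\<lambda>x. x \<noteq> 0) F"
    using F(2) by (rule filter_leD) (simp add: eventually_at_filter)
  ultimately have "eventually (\<lambda>x. w x = u x) F"
    by (auto elim: eventually_mono)
  then have "(u \<longlongrightarrow> c') F"
    using w(3) tendsto_cong by blast
  then show "c' = c"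
    using tendsto_unique F(1) lim by blast
qed

text \<open>A jump of \<open>u\<close> at 0 does no harm, because \<psi> vanishes on a neighbourhood
  of 0: the open sets \<open>- {0}\<close> and \<open>- S\<close> cover the line.\<close>

lemma continuous_on_scaleR_cutoff:
  fixes u :: "real \<Rightarrow> 'a::real_normed_vector"
  assumes "continuous_on UNIV \<psi>" and u: "continuous_on (- {0}) u"
    and S: "closed S" "0 \<notin> S" and zero: "\<And>x. x \<notin> S \<Longrightarrow> \<psi> x = 0"
  shows "continuous_on UNIV (\<lambda>x. \<psi> x *\<^sub>R u x)"
proof -
  have "continuous_on (- {0}) (\<lambda>x. \<psi> x *\<^sub>R u x)"
    by (intro continuous_intros u continuous_on_subset[OF assms(1)]) auto
  moreover have "continuous_on (- S) (\<lambda>x. \<psi> x *\<^sub>R u x)"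
    by (rule continuous_on_eq[OF continuous_on_const[of _ 0]]) (auto simp: zero)
  ultimately have "continuous_on (- {0} \<union> - S) (\<lambda>x. \<psi> x *\<^sub>R u x)"
    by (intro continuous_on_open_Un) (use S in auto)
  moreover have "- {0} \<union> - S = UNIV"
    using S by auto
  ultimately show ?thesis
    by simp
qed

text \<open>Integration by parts without a boundary term at 0: the product of \<phi> and
  \<open>u\<close> is differentiable on the whole line even if \<open>u\<close> jumps, since \<phi>
  vanishes near 0. Its derivative is continuous with compact support, so it integrates to 0.\<close>

lemma weak_deriv_C1:
  fixes u d :: "real \<Rightarrow> 'a::euclidean_space"
  assumes u: "\<And>x. x \<noteq> 0 \<Longrightarrow> (u has_vector_derivative d x) (at x)"
    and d: "continuous_on (- {0}) d"
  shows "weak_deriv u d"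
  unfolding weak_deriv_def
proof (intro allI impI)
  fix \<phi> assume "test_function \<phi>"
  then obtain D :: "nat \<Rightarrow> real \<Rightarrow> real" where D: "D 0 = \<phi>"
      "\<And>n x. (D n has_real_derivative D (Suc n) x) (at x)"
    and cpt: "compact (closure {x. \<phi> x \<noteq> 0})" and S0: "0 \<notin> closure {x. \<phi> x \<noteq> 0}"
    unfolding test_function_def smooth_def by auto
  define S where "S = closure {x. \<phi> x \<noteq> 0}"
  have S: "closed S" "0 \<notin> S"
    using S0 by (auto simp: S_def)
  have \<phi>0: "\<phi> x = 0" if "x \<notin> S" for x
    using that closure_subset[of "{x. \<phi> x \<noteq> 0}"] by (auto simp: S_def)
  have deriv_\<phi>: "deriv \<phi> = D 1"
    using D by (metis DERIV_imp_deriv One_nat_def ext)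
  have D10: "D 1 x = 0" if "x \<notin> S" for x
  proof -
    have "((\<lambda>x. 0) has_real_derivative D 1 x) (at x)"
      by (rule has_field_derivative_transform_within_open[of \<phi> _ _ "- S"])
        (use D S that \<phi>0 in \<open>auto simp: open_Compl\<close>)
    then show ?thesis
      using DERIV_unique DERIV_const by blast
  qed
  have contD: "continuous_on UNIV (D n)" for n
    using D(2) by (meson DERIV_isCont continuous_at_imp_continuous_on)
  have contu: "continuous_on (- {0}) u"
    by (intro continuous_at_imp_continuous_on ballI)
      (use u has_vector_derivative_continuous in fastforce)
  have c1: "continuous_on UNIV (\<lambda>x. D 1 x *\<^sub>R u x)"
    by (rule continuous_on_scaleR_cutoff[OF contD contu S]) (use D10 in auto)
  have c2: "continuous_on UNIV (\<lambda>x. \<phi> x *\<^sub>R d x)"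
    by (rule continuous_on_scaleR_cutoff[OF _ d S]) (use contD[of 0] D \<phi>0 in auto)
  obtain R where R: "R > 0" "\<And>x. x \<in> S \<Longrightarrow> norm x \<le> R"
    using compact_imp_bounded[OF cpt] unfolding bounded_pos S_def by auto
  have out: "x \<notin> S" if "x \<notin> {-R..R}" for x
    using R(2)[of x] that by auto
  \<comment> \<open>The interval exceeds the support bound \<open>R\<close> by one, so that \<phi>
    vanishes at both endpoints in the fundamental theorem of calculus below.\<close>
  have int: "integrable lborel v \<and> integral\<^sup>L lborel v = integral\<^sup>L lborel (\<lambda>x. indicator {-(R+1)..R+1} x *\<^sub>R v x)"
    if "continuous_on UNIV v" "\<And>x. x \<notin> S \<Longrightarrow> v x = 0" for v :: "real \<Rightarrow> 'a"
  proof -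
    have "v = (\<lambda>x. indicator {-(R+1)..R+1} x *\<^sub>R v x)"
      using out that(2) by (fastforce simp: indicator_def)
    moreover have "integrable lborel (\<lambda>x. indicator {-(R+1)..R+1} x *\<^sub>R v x)"
      by (intro borel_integrable_compact continuous_on_subset[OF that(1)]) auto
    ultimately show ?thesis
      by metis
  qed
  define g where "g = (\<lambda>x. D 1 x *\<^sub>R u x + \<phi> x *\<^sub>R d x)"
  have G: "((\<lambda>x. \<phi> x *\<^sub>R u x) has_vector_derivative g x) (at x)" for x
  proof (cases "x = 0")
    case False
    have "(\<phi> has_real_derivative D 1 x) (at x)"
      using D(2)[of 0] D(1) by simp
    then show ?thesis
      using has_vector_derivative_scaleR[OF _ u[OF False]] False
      by (fastforce simp: g_def add.commute)
  next
    case True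
    have "((\<lambda>x. 0) has_vector_derivative (0::'a)) (at 0)"
      by simp
    then have "((\<lambda>x. \<phi> x *\<^sub>R u x) has_vector_derivative (0::'a)) (at 0)"
      by (rule has_vector_derivative_transform_within_open[of _ _ _ "- S"])
        (use S \<phi>0 in \<open>auto simp: open_Compl\<close>)
    then show ?thesis
      using True D10 \<phi>0 S by (simp add: g_def)
  qed
  have contg: "continuous_on UNIV g"
    unfolding g_def by (intro continuous_intros c1 c2)
  have "integral\<^sup>L lborel g = \<phi> (R+1) *\<^sub>R u (R+1) - \<phi> (-(R+1)) *\<^sub>R u (-(R+1))"
  proof -
    have "integral\<^sup>L lborel g = integral\<^sup>L lborel (\<lambda>x. indicator {-(R+1)..R+1} x *\<^sub>R g x)"
      using int[OF contg] D10 \<phi>0 by (auto simp: g_def)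
    also have "\<dots> = \<phi> (R+1) *\<^sub>R u (R+1) - \<phi> (-(R+1)) *\<^sub>R u (-(R+1))"
      by (intro integral_FTC_atLeastAtMost continuous_on_subset[OF contg]
          has_vector_derivative_at_within[OF G]) (use R in auto)
    finally show ?thesis .
  qed
  also have "\<dots> = 0"
    using out \<phi>0 R(1) by simp
  also have "integral\<^sup>L lborel g = (LINT x|lborel. D 1 x *\<^sub>R u x) + (LINT x|lborel. \<phi> x *\<^sub>R d x)"
    unfolding g_def using int[OF c1] int[OF c2] D10 \<phi>0
    by (intro Bochner_Integration.integral_add) auto
  finally show "(LINT x|lborel. deriv \<phi> x *\<^sub>R u x) = - (LINT x|lborel. \<phi> x *\<^sub>R d x)"
    unfolding deriv_\<phi> by (simp add: eq_neg_iff_add_eq_0)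
qed

section \<open>Two-sided exponentials\<close>

lemma AE_lborel_imp_ex_Ioo:
  fixes a b :: real
  assumes "AE x in lborel. P x" "a < b"
  shows "\<exists>x\<in>{a<..<b}. P x"
proof (rule ccontr)
  assume none: "\<not> ?thesis"
  obtain N where N: "N \<in> null_sets lborel" "{x \<in> space lborel. \<not> P x} \<subseteq> N"
    using assms(1) unfolding eventually_ae_filter by blast
  then have "negligible N"
    by (simp add: negligible_iff_null_sets null_sets_completionI)
  then have "negligible {a<..<b}"
    by (rule negligible_subset) (use N(2) none in auto)
  then show False
    using open_not_negligible[of "{a<..<b}"] assms(2) by auto
qed

lemma norm_vector_smult: "norm (c *s (v :: complex ^ 'n)) = cmod c * norm v"
  by (simp add: norm_vec_def norm_mult L2_set_right_distrib)

lemma bounded_bilinear_vector_smult: "bounded_bilinear ((*s) :: complex \<Rightarrow> complex ^ 'n \<Rightarrow> _)"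
  by (rule bounded_bilinear.intro)
    (auto simp: vec_eq_iff algebra_simps norm_vector_smult intro!: exI[of _ 1])

lemmas bounded_linear_vector_smult_left =
  bounded_bilinear.bounded_linear_left[OF bounded_bilinear_vector_smult]

lemma vec2_eq_iff: "(x :: 'a ^ 2) = y \<longleftrightarrow> x $ 1 = y $ 1 \<and> x $ 2 = y $ 2"
  by (simp add: vec_eq_iff forall_2)

text \<open>\<open>A\<close> is the even part and \<open>B\<close> the odd part. Hence the mean at 0
  is \<open>A\<close> and the jump is twice \<open>B\<close>, which turns conditions at 0 into
  linear equations for the two vectors.\<close>

definition two_sided_exp :: "complex \<Rightarrow> spinor \<Rightarrow> spinor \<Rightarrow> real \<Rightarrow> spinor" where
  "two_sided_exp k A B x = exp (- k * of_real \<bar>x\<bar>) *s (A + sgn x *\<^sub>R B)"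

lemma borel_measurable_two_sided_exp [measurable]:
  "two_sided_exp k A B \<in> borel_measurable borel"
proof -
  have "(\<lambda>x. exp (- k * of_real \<bar>x\<bar>) *s v) \<in> borel_measurable borel" for v :: spinor
    by (intro borel_measurable_continuous_onI
        bounded_linear.continuous_on[OF bounded_linear_vector_smult_left] continuous_intros)
  then have "(\<lambda>x. exp (- k * of_real \<bar>x\<bar>) *s A + sgn x *\<^sub>R (exp (- k * of_real \<bar>x\<bar>) *s B))
      \<in> borel_measurable borel"
    by measurable
  moreover have "two_sided_exp k A B =
      (\<lambda>x. exp (- k * of_real \<bar>x\<bar>) *s A + sgn x *\<^sub>R (exp (- k * of_real \<bar>x\<bar>) *s B))"
    by (auto simp: fun_eq_iff two_sided_exp_def vec_eq_iff algebra_simps)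
  ultimately show ?thesis
    by simp
qed

lemma norm_two_sided_exp_le:
  assumes "c \<le> Re k"
  shows "norm (two_sided_exp k A B x) \<le> (norm A + norm B) * exp (- c * \<bar>x\<bar>)"
proof -
  have "norm (A + sgn x *\<^sub>R B) \<le> norm A + norm B"
    by (rule order.trans[OF norm_triangle_ineq])
      (auto simp: abs_sgn_eq)
  moreover have "cmod (exp (- k * of_real \<bar>x\<bar>)) \<le> exp (- c * \<bar>x\<bar>)"
    using assms by (simp add: mult_right_mono)
  ultimately show ?thesis
    unfolding two_sided_exp_def norm_vector_smult
    by (subst mult.commute) (intro mult_mono, auto)
qed

text \<open>Differentiation brings down - k sgn x, and sgn x squares to 1, so the even and odd parts
  change places.\<close>

lemma has_vector_derivative_two_sided_exp:
  assumes "x \<noteq> 0"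
  shows "(two_sided_exp k A B has_vector_derivative
    two_sided_exp k (- k *s B) (- k *s A) x) (at x)"
proof -
  define s where "s = sgn x"
  define c where "c = - k * of_real s"
  have s: "s * s = 1" "\<bar>x\<bar> = s * x" "s \<noteq> 0"
    using assms by (auto simp: s_def sgn_if)
  have "((\<lambda>z. exp (c * z)) has_field_derivative c * exp (c * of_real x)) (at (of_real x))"
    by (auto intro!: derivative_eq_intros)
  then have "((\<lambda>y. exp (c * of_real y)) has_vector_derivative c * exp (c * of_real x)) (at x)"
    by (rule has_vector_derivative_real_field)
  then have *: "((\<lambda>y. exp (c * of_real y) *s (A + s *\<^sub>R B)) has_vector_derivative
      (c * exp (c * of_real x)) *s (A + s *\<^sub>R B)) (at x)"
    by (rule bounded_linear.has_vector_derivative[OF bounded_linear_vector_smult_left])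
  have "(c * exp (c * of_real x)) *s (A + s *\<^sub>R B) = two_sided_exp k (- k *s B) (- k *s A) x"
  proof -
    have "of_real s * of_real s = (1::complex)"
      using s(1) by (simp flip: of_real_mult)
    moreover from this have "c * (a + of_real s * b) = - (k * b) - of_real s * (k * a)" for a b
      unfolding c_def by (simp add: algebra_simps)
    ultimately show ?thesis
      unfolding two_sided_exp_def vec_eq_iff
      by (simp add: s s_def[symmetric] c_def scaleR_conv_of_real[where 'a=complex] mult_ac)
  qed
  with * have "((\<lambda>y. exp (c * of_real y) *s (A + s *\<^sub>R B)) has_vector_derivative
      two_sided_exp k (- k *s B) (- k *s A) x) (at x)"
    by simp
  then show ?thesis
  proof (rule has_vector_derivative_transform_within_open)
    show "open {y. s * y > 0}"
      by (intro open_Collect_less continuous_intros)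
    show "x \<in> {y. s * y > 0}"
      using s assms by (auto simp: s_def sgn_if)
    fix y assume "y \<in> {y. s * y > 0}"
    then have "\<bar>y\<bar> = s * y" "sgn y = s"
      using assms by (auto simp: s_def sgn_if split: if_splits)
    then show "exp (c * of_real y) *s (A + s *\<^sub>R B) = two_sided_exp k A B y"
      by (simp add: two_sided_exp_def c_def mult_ac)
  qed
qed

lemma continuous_on_two_sided_exp: "continuous_on (- {0}) (two_sided_exp k A B)"
  by (intro continuous_at_imp_continuous_on ballI)
    (use has_vector_derivative_two_sided_exp has_vector_derivative_continuous in fastforce)

lemma tendsto_two_sided_exp:
  "(two_sided_exp k A B \<longlongrightarrow> A + B) (at_right 0)"
  "(two_sided_exp k A B \<longlongrightarrow> A - B) (at_left 0)"
proof -
  have lim: "((\<lambda>x::real. exp (- k * of_real \<bar>x\<bar>) *s v) \<longlongrightarrow> v) (at 0 within S)" for S and v :: spinor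
    by (rule tendsto_eq_rhs[OF bounded_linear.tendsto[OF bounded_linear_vector_smult_left]])
      (auto intro!: tendsto_eq_intros)
  show "(two_sided_exp k A B \<longlongrightarrow> A + B) (at_right 0)"
    using lim by (rule Lim_transform_eventually)
      (auto simp: eventually_at_filter two_sided_exp_def)
  show "(two_sided_exp k A B \<longlongrightarrow> A - B) (at_left 0)"
    using lim by (rule Lim_transform_eventually)
      (auto simp: eventually_at_filter two_sided_exp_def)
qed

text \<open>Sums of two exponentials are needed because r and s mix the two modes u and w, whose
  decay rates differ. The slower rate bounds both.\<close>

lemma L2_two_sided_exp_add:
  assumes "Re k > 0" "Re k' > 0"
  shows "(\<lambda>x. two_sided_exp k A B x + two_sided_exp k' A' B' x) \<in> L2"
proof (rule L2_exp_decay)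
  show "norm (two_sided_exp k A B x + two_sided_exp k' A' B' x) \<le>
      (norm A + norm B + (norm A' + norm B')) * exp (- min (Re k) (Re k') * \<bar>x\<bar>)" for x
    unfolding distrib_right[of "norm A + norm B"]
    by (rule order.trans[OF norm_triangle_ineq])
      (intro add_mono norm_two_sided_exp_le, auto)
qed (use assms in auto)

lemma H1_deriv_two_sided_exp_add:
  assumes "Re k > 0" "Re k' > 0"
  shows "H1_deriv (\<lambda>x. two_sided_exp k A B x + two_sided_exp k' A' B' x)
    (\<lambda>x. two_sided_exp k (- k *s B) (- k *s A) x + two_sided_exp k' (- k' *s B') (- k' *s A') x)"
  unfolding H1_deriv_def
  by (intro conjI L2_two_sided_exp_add assms weak_deriv_C1 has_vector_derivative_add
      has_vector_derivative_two_sided_exp continuous_intros continuous_on_two_sided_exp)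

lemma trace0_two_sided_exp_add:
  shows "trace0 (at_right 0) (\<lambda>x. two_sided_exp k A B x + two_sided_exp k' A' B' x) =
      A + B + (A' + B')"
    and "trace0 (at_left 0) (\<lambda>x. two_sided_exp k A B x + two_sided_exp k' A' B' x) =
      A - B + (A' - B')"
  by (intro trace0_eq tendsto_add tendsto_two_sided_exp continuous_intros
      continuous_on_two_sided_exp; simp add: at_le)+

lemma jump0_two_sided_exp_add:
  "jump0 (\<lambda>x. two_sided_exp k A B x + two_sided_exp k' A' B' x) = 2 *\<^sub>R (B + B')"
  by (simp add: jump0_def trace0_two_sided_exp_add scaleR_2)

lemma mean0_two_sided_exp_add:
  "mean0 (\<lambda>x. two_sided_exp k A B x + two_sided_exp k' A' B' x) = A + A'"
  by (simp add: mean0_def trace0_two_sided_exp_add vec_eq_iff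
      scaleR_conv_of_real[where 'a=complex] field_simps)

lemma two_sided_exp_0 [simp]: "two_sided_exp k 0 0 x = 0"
  by (simp add: two_sided_exp_def)

text \<open>One point on each side of 0 suffices: it gives A + B = 0 on the right and A - B = 0 on
  the left.\<close>

lemma two_sided_exp_AE_eq_0:
  assumes "AE x in lborel. two_sided_exp k A B x = 0"
  shows "A = 0 \<and> B = 0"
proof -
  obtain x y :: real where x: "x \<in> {0<..<1}" "two_sided_exp k A B x = 0"
      and y: "y \<in> {-1<..<0}" "two_sided_exp k A B y = 0"
    using AE_lborel_imp_ex_Ioo[OF assms, of 0 1] AE_lborel_imp_ex_Ioo[OF assms, of "-1" 0]
    by auto
  have "A + B = 0"
    using x by (simp add: two_sided_exp_def del: vector_add_ldistrib)
  moreover have "A - B = 0"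
    using y by (simp add: two_sided_exp_def del: vector_ssub_ldistrib)
  ultimately have ab: "A $ i + B $ i = 0 \<and> A $ i - B $ i = 0" for i
    by (metis vector_add_component vector_minus_component zero_index)
  have "A $ i = 0 \<and> B $ i = 0" for i
    using ab[of i] by (simp add: complex_eq_iff)
  then show ?thesis
    by (simp add: vec_eq_iff)
qed

section \<open>Free Dirac equation for two-sided exponentials\<close>

lemma dirac_component:
  "dirac m u d x $ 1 = d x $ 2 + of_real m * u x $ 1"
  "dirac m u d x $ 2 = - d x $ 1 - of_real m * u x $ 2"
  by (simp_all add: dirac_def sigma2_def sigma3_def matrix_vector_mult_def sum_2 vector_2
      scaleR_conv_of_real[where 'a=complex] algebra_simps flip: mult.assoc)

lemma i_sigma2_component:
  "(\<i> *s (sigma2 *v z)) $ 1 = z $ 2" "(\<i> *s (sigma2 *v z)) $ 2 = - z $ 1"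
  by (simp_all add: sigma2_def matrix_vector_mult_def sum_2 vector_2 flip: mult.assoc)

lemma coupling_component:
  "(coupling \<epsilon> *v z) $ 1 = z $ 1 + of_real \<epsilon> * z $ 2"
  "(coupling \<epsilon> *v z) $ 2 = of_real \<epsilon> * z $ 1 - z $ 2"
  by (simp_all add: coupling_def sigma1_def sigma3_def matrix_vector_mult_def sum_2 vector_2
      scaleR_conv_of_real[where 'a=complex])

text \<open>The free Dirac equation with energy \<open>E\<close> off 0, in components: the first two
  equations compare the even parts, the last two the odd parts.\<close>

definition dirac_exp :: "real \<Rightarrow> complex \<Rightarrow> complex \<Rightarrow> spinor \<Rightarrow> spinor \<Rightarrow> bool" where
  "dirac_exp m E k A B \<longleftrightarrow>
    - k * B $ 2 + of_real m * A $ 1 = E * A $ 1 \<and> k * B $ 1 - of_real m * A $ 2 = E * A $ 2 \<and>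
    - k * A $ 2 + of_real m * B $ 1 = E * B $ 1 \<and> k * A $ 1 - of_real m * B $ 2 = E * B $ 2"

lemma dirac_two_sided_exp:
  assumes "dirac_exp m E k A B"
  shows "dirac m (two_sided_exp k A B) (two_sided_exp k (- k *s B) (- k *s A)) x =
    E *s two_sided_exp k A B x"
proof -
  define t e where "t = complex_of_real (sgn x)" and "e = exp (- (k * of_real \<bar>x\<bar>))"
  have "e * (- k * B $ 2 + of_real m * A $ 1) + t * (e * (- k * A $ 2 + of_real m * B $ 1)) =
      e * (E * A $ 1) + t * (e * (E * B $ 1))"
    "e * (k * B $ 1 - of_real m * A $ 2) + t * (e * (k * A $ 1 - of_real m * B $ 2)) =
      e * (E * A $ 2) + t * (e * (E * B $ 2))"
    using assms by (simp_all only: dirac_exp_def)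
  then show ?thesis
    unfolding vec2_eq_iff dirac_component two_sided_exp_def
    by (simp add: scaleR_conv_of_real[where 'a=complex] algebra_simps flip: t_def e_def)
qed

section \<open>Modes of the linearization\<close>

lemma dirac_exp_scale: "dirac_exp m E k A B \<Longrightarrow> dirac_exp m E k (c *s A) (c *s B)"
  unfolding dirac_exp_def
  by (simp add: mult.left_commute[of _ c] flip: distrib_left right_diff_distrib)

lemma two_sided_exp_scale: "two_sided_exp k (c *s A) (c *s B) x = c *s two_sided_exp k A B x"
  by (simp add: two_sided_exp_def vec_eq_iff algebra_simps scaleR_conv_of_real[where 'a=complex])

lemma dirac_add:
  "dirac m (\<lambda>x. u x + w x) (\<lambda>x. d x + e x) x = dirac m u d x + dirac m w e x"
  by (simp add: vec2_eq_iff dirac_component algebra_simps)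

text \<open>The jump conditions for r and s, rewritten for one of the modes u = r + i s, w = r - i
  s. \<open>A\<close> and \<open>B\<close> are the mean and half the jump of that mode,
  \<open>A'\<close> is the mean of the other one. Since u + w = 2 r, the factor 2 g becomes
  g.\<close>

definition jump_condition ::
    "real \<Rightarrow> real \<Rightarrow> real \<Rightarrow> spinor \<Rightarrow> spinor \<Rightarrow> spinor \<Rightarrow> spinor \<Rightarrow> bool" where
  "jump_condition \<epsilon> f g v A B A' \<longleftrightarrow>
    2 * B $ 2 = f * (A $ 1 + \<epsilon> * A $ 2) + g * v $ 1 * (v $ 1 * (A $ 1 + A' $ 1) + v $ 2 * (A $ 2 + A' $ 2)) \<and>
    - 2 * B $ 1 = f * (\<epsilon> * A $ 1 - A $ 2) + g * v $ 2 * (v $ 1 * (A $ 1 + A' $ 1) + v $ 2 * (A $ 2 + A' $ 2))"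

text \<open>Off 0 the eigenvalue equation decouples: u has energy \<omega> + i z and w has energy
  \<omega> - i z. The unprimed data belong to u, the primed data to w, and only the jump conditions
  couple them.\<close>

definition linear_mode where
  "linear_mode m \<omega> \<epsilon> f g v z k A B k' A' B' \<longleftrightarrow> Re k > 0 \<and> Re k' > 0 \<and>
    dirac_exp m (of_real \<omega> + \<i> * z) k A B \<and> dirac_exp m (of_real \<omega> - \<i> * z) k' A' B' \<and>
    jump_condition \<epsilon> f g v A B A' \<and> jump_condition \<epsilon> f g v A' B' A \<and>
    \<not> (A = 0 \<and> B = 0 \<and> A' = 0 \<and> B' = 0)"

text \<open>Exchanging u and w means replacing s by - s, which reverses the sign of the
  operator.\<close>

lemma linear_mode_uminus:
  "linear_mode m \<omega> \<epsilon> f g v z k A B k' A' B' \<Longrightarrow> linear_mode m \<omega> \<epsilon> f g v (- z) k' A' B' k A B"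
  by (auto simp: linear_mode_def)

definition cnj_vec :: "spinor \<Rightarrow> spinor" where
  "cnj_vec A = (\<chi> i. cnj (A $ i))"

lemma cnj_vec_component [simp]: "cnj_vec A $ i = cnj (A $ i)"
  by (simp add: cnj_vec_def)

lemma cnj_vec_eq_0_iff [simp]: "cnj_vec A = 0 \<longleftrightarrow> A = 0"
  by (simp add: vec2_eq_iff)

lemma dirac_exp_cnj:
  assumes "dirac_exp m E k A B"
  shows "dirac_exp m (cnj E) (cnj k) (cnj_vec A) (cnj_vec B)"
  using assms[unfolded dirac_exp_def, THEN conjunct1, THEN arg_cong[of _ _ cnj]]
    assms[unfolded dirac_exp_def, THEN conjunct2, THEN conjunct1, THEN arg_cong[of _ _ cnj]]
    assms[unfolded dirac_exp_def, THEN conjunct2, THEN conjunct2, THEN conjunct1, THEN arg_cong[of _ _ cnj]]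
    assms[unfolded dirac_exp_def, THEN conjunct2, THEN conjunct2, THEN conjunct2, THEN arg_cong[of _ _ cnj]]
  by (simp only: dirac_exp_def cnj_vec_component complex_cnj_add complex_cnj_mult complex_cnj_diff
      complex_cnj_minus complex_cnj_complex_of_real simp_thms)

lemma jump_condition_cnj:
  assumes "jump_condition \<epsilon> f g v A B A'" "cnj_vec v = v"
  shows "jump_condition \<epsilon> f g v (cnj_vec A) (cnj_vec B) (cnj_vec A')"
proof -
  have v: "cnj (v $ i) = v $ i" for i
    using assms(2) by (metis cnj_vec_component)
  show ?thesis
    using assms(1)[unfolded jump_condition_def, THEN conjunct1, THEN arg_cong[of _ _ cnj]]
      assms(1)[unfolded jump_condition_def, THEN conjunct2, THEN arg_cong[of _ _ cnj]]
    by (simp only: jump_condition_def cnj_vec_component v complex_cnj_add complex_cnj_mult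
        complex_cnj_diff complex_cnj_minus complex_cnj_complex_of_real complex_cnj_numeral simp_thms)
qed

text \<open>The operator has real coefficients because \<open>v\<close> is real. Conjugation turns
  the energy \<omega> + i z into \<omega> - i \<open>cnj z\<close>, so the conjugate of u takes the
  place of w and conversely.\<close>

lemma linear_mode_cnj:
  assumes "linear_mode m \<omega> \<epsilon> f g v z k A B k' A' B'" "cnj_vec v = v"
  shows "linear_mode m \<omega> \<epsilon> f g v (cnj z) (cnj k') (cnj_vec A') (cnj_vec B')
    (cnj k) (cnj_vec A) (cnj_vec B)"
  using assms dirac_exp_cnj[of m "of_real \<omega> + \<i> * z" k A B] dirac_exp_cnj[of m "of_real \<omega> - \<i> * z" k' A' B']
  by (auto simp: linear_mode_def jump_condition_cnj)

section \<open>From modes to eigenvalues of the linearization\<close>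

lemma jump_matrix_component:
  fixes v z :: spinor
  shows "((f *\<^sub>R coupling \<epsilon> + (2 * g) *\<^sub>R (\<chi> i j. v $ i * v $ j)) *v z) $ 1 =
      f * (z $ 1 + \<epsilon> * z $ 2) + 2 * g * v $ 1 * (v $ 1 * z $ 1 + v $ 2 * z $ 2)"
    and "((f *\<^sub>R coupling \<epsilon> + (2 * g) *\<^sub>R (\<chi> i j. v $ i * v $ j)) *v z) $ 2 =
      f * (\<epsilon> * z $ 1 - z $ 2) + 2 * g * v $ 2 * (v $ 1 * z $ 1 + v $ 2 * z $ 2)"
  by (simp_all add: matrix_vector_mult_def sum_2 coupling_def sigma1_def sigma3_def vector_2
      scaleR_conv_of_real[where 'a=complex] algebra_simps)

lemma scaled_coupling_component:
  fixes z :: spinor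
  shows "((f *\<^sub>R coupling \<epsilon>) *v z) $ 1 = f * (z $ 1 + \<epsilon> * z $ 2)"
    and "((f *\<^sub>R coupling \<epsilon>) *v z) $ 2 = f * (\<epsilon> * z $ 1 - z $ 2)"
  using jump_matrix_component[of f \<epsilon> 0] by simp_all

lemma linear_mode_imp_point_spectrum:
  assumes \<tau>: "\<tau> = tau m \<omega> \<epsilon> \<alpha> \<beta>"
    and mode: "linear_mode m \<omega> \<epsilon> (nonlin \<kappa> \<tau>) (deriv (nonlin \<kappa>) \<tau>) (lin_vec m \<omega> \<epsilon> \<alpha> \<beta>) z k A B k' A' B'"
  shows "z \<in> point_spectrum (linearization m \<kappa> \<omega> \<epsilon> \<alpha> \<beta>)"
proof -
  \<comment> \<open>The constants invert u = r + i s, w = r - i s: r = (u + w) / 2 and s = (u - w) /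
    (2 i), where 1 / (2 i) = - i / 2.\<close>
  define c where "c = - \<i> / 2"
  define h where "h = (1/2 :: complex)"
  define r where "r = (\<lambda>x. two_sided_exp k (h *s A) (h *s B) x + two_sided_exp k' (h *s A') (h *s B') x)"
  define s where "s = (\<lambda>x. two_sided_exp k (c *s A) (c *s B) x + two_sided_exp k' (- c *s A') (- c *s B') x)"
  define dr where "dr = (\<lambda>x. two_sided_exp k (- k *s (h *s B)) (- k *s (h *s A)) x
    + two_sided_exp k' (- k' *s (h *s B')) (- k' *s (h *s A')) x)"
  define ds where "ds = (\<lambda>x. two_sided_exp k (- k *s (c *s B)) (- k *s (c *s A)) x
    + two_sided_exp k' (- k' *s (- c *s B')) (- k' *s (- c *s A')) x)"
  define u where "u = (\<lambda>x. (r x, s x))"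
  have k: "Re k > 0" "Re k' > 0"
    and eqs: "dirac_exp m (of_real \<omega> + \<i> * z) k A B" "dirac_exp m (of_real \<omega> - \<i> * z) k' A' B'"
    and jumps: "jump_condition \<epsilon> (nonlin \<kappa> \<tau>) (deriv (nonlin \<kappa>) \<tau>) (lin_vec m \<omega> \<epsilon> \<alpha> \<beta>) A B A'"
      "jump_condition \<epsilon> (nonlin \<kappa> \<tau>) (deriv (nonlin \<kappa>) \<tau>) (lin_vec m \<omega> \<epsilon> \<alpha> \<beta>) A' B' A"
    and nontriv: "\<not> (A = 0 \<and> B = 0 \<and> A' = 0 \<and> B' = 0)"
    using mode by (auto simp: linear_mode_def)
  have H1: "H1_deriv r dr" "H1_deriv s ds"
    unfolding r_def dr_def s_def ds_def using k by (rule H1_deriv_two_sided_exp_add)+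
  have L2: "(\<lambda>x. (v x, w x)) \<in> L2" if "v \<in> L2" "w \<in> L2" for v w :: "real \<Rightarrow> spinor"
    using that by (auto simp: L2_def norm_Pair)
  have uL2: "u \<in> L2"
    unfolding u_def using H1 by (intro L2) (auto simp: H1_deriv_def)
  have zuL2: "(\<lambda>x. cscale z (u x)) \<in> L2"
  proof -
    have "(\<lambda>x. z *s r x) \<in> L2" "(\<lambda>x. z *s s x) \<in> L2"
      unfolding r_def s_def vector_add_ldistrib two_sided_exp_scale[symmetric]
      using k by (rule L2_two_sided_exp_add)+
    then show ?thesis
      by (auto simp: u_def cscale_def intro: L2)
  qed
  have Dr: "dirac m r dr x = (of_real \<omega> + \<i> * z) *s (h *s two_sided_exp k A B x)
      + (of_real \<omega> - \<i> * z) *s (h *s two_sided_exp k' A' B' x)" for x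
    unfolding r_def dr_def dirac_add
      dirac_two_sided_exp[OF dirac_exp_scale[OF eqs(1)]] dirac_two_sided_exp[OF dirac_exp_scale[OF eqs(2)]]
    unfolding two_sided_exp_scale by (rule refl)
  have Ds: "dirac m s ds x = (of_real \<omega> + \<i> * z) *s (c *s two_sided_exp k A B x)
      + (of_real \<omega> - \<i> * z) *s (- c *s two_sided_exp k' A' B' x)" for x
    unfolding s_def ds_def dirac_add
      dirac_two_sided_exp[OF dirac_exp_scale[OF eqs(1)]] dirac_two_sided_exp[OF dirac_exp_scale[OF eqs(2)]]
    unfolding two_sided_exp_scale by (rule refl)
  have eq: "cscale z (u x) = (dirac m s ds x - \<omega> *\<^sub>R s x, - dirac m r dr x + \<omega> *\<^sub>R r x)" for x
    unfolding Dr Ds unfolding u_def cscale_def r_def s_def two_sided_exp_scale c_def h_def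
    by (simp add: vec2_eq_iff scaleR_conv_of_real[where 'a=complex] field_simps)
  \<comment> \<open>Each of the two lists holds one component for both modes. Averaging the modes
    gives the condition for r; subtracting them cancels the terms with v and gives the condition for
    s.\<close>
  note jumps1 = jumps[unfolded jump_condition_def, THEN conjunct1]
    and jumps2 = jumps[unfolded jump_condition_def, THEN conjunct2]
  have jr: "\<i> *s (sigma2 *v jump0 r) - (nonlin \<kappa> \<tau> *\<^sub>R coupling \<epsilon> +
      (2 * deriv (nonlin \<kappa>) \<tau>) *\<^sub>R (\<chi> i j. lin_vec m \<omega> \<epsilon> \<alpha> \<beta> $ i * lin_vec m \<omega> \<epsilon> \<alpha> \<beta> $ j)) *v mean0 r = 0"
    unfolding r_def jump0_two_sided_exp_add mean0_two_sided_exp_add vec2_eq_iff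
      vector_minus_component i_sigma2_component jump_matrix_component
    unfolding vector_scaleR_component vector_add_component vector_smult_component scaleR_2 zero_index
  proof (intro conjI, goal_cases)
    case 1
    show ?case using jumps1 by algebra
  next
    case 2
    show ?case using jumps2 by algebra
  qed
  have js: "\<i> *s (sigma2 *v jump0 s) - (nonlin \<kappa> \<tau> *\<^sub>R coupling \<epsilon>) *v mean0 s = 0"
    unfolding s_def jump0_two_sided_exp_add mean0_two_sided_exp_add vec2_eq_iff
      vector_minus_component i_sigma2_component scaled_coupling_component
    unfolding vector_scaleR_component vector_add_component vector_smult_component scaleR_2 zero_index
  proof (intro conjI, goal_cases)
    case 1
    show ?case using jumps1 by algebra
  next
    case 2
    show ?case using jumps2 by algebra
  qed
  have "\<not> (AE x in lborel. u x = 0)"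
  proof
    assume ae: "AE x in lborel. u x = 0"
    have "two_sided_exp k A B x = fst (u x) + \<i> *s snd (u x)"
        "two_sided_exp k' A' B' x = fst (u x) - \<i> *s snd (u x)" for x
      unfolding u_def fst_conv snd_conv r_def s_def two_sided_exp_scale c_def h_def vec2_eq_iff
      by (simp_all add: field_simps flip: mult.assoc)
    then have "AE x in lborel. two_sided_exp k A B x = 0" "AE x in lborel. two_sided_exp k' A' B' x = 0"
      using ae by auto
    then show False
      using two_sided_exp_AE_eq_0 nontriv by blast
  qed
  moreover have "linearization m \<kappa> \<omega> \<epsilon> \<alpha> \<beta> u (\<lambda>x. cscale z (u x))"
  proof -
    note facts = zuL2[unfolded u_def] eq[unfolded u_def]
    show ?thesis
      unfolding linearization_def Let_def u_def fst_conv snd_conv \<tau>[symmetric]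
      by (intro conjI exI[of _ dr] exI[of _ ds] AE_I2 facts H1 jr js)
  qed
  ultimately show ?thesis
    using uL2 by (auto simp: point_spectrum_def)
qed

text \<open>An eigenfunction solves the resolvent equation with right-hand side 0, so the norm bound
  would force it to vanish almost everywhere.\<close>

lemma point_spectrum_subset_spectrum: "point_spectrum A \<subseteq> spectrum A"
proof
  fix z assume "z \<in> point_spectrum A"
  then obtain u where u: "u \<in> L2" "\<not> (AE x in lborel. u x = 0)" "A u (\<lambda>x. cscale z (u x))"
    by (auto simp: point_spectrum_def)
  show "z \<in> spectrum A"
    unfolding spectrum_def
  proof
    assume "z \<in> resolvent_set A"
    then obtain C where C: "\<And>u h. u \<in> L2 \<Longrightarrow> h \<in> L2 \<Longrightarrow>
        A u (\<lambda>x. h x + cscale z (u x)) \<Longrightarrow> L2_norm u \<le> C * L2_norm h"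
      by (auto simp: resolvent_set_def)
    have "L2_norm u \<le> C * L2_norm (\<lambda>x. 0 :: spinor \<times> spinor)"
      by (rule C) (use u in \<open>auto simp: L2_def\<close>)
    then have "(LINT x|lborel. (norm (u x))\<^sup>2) \<le> 0"
      by (simp add: L2_norm_def)
    moreover have "(LINT x|lborel. (norm (u x))\<^sup>2) \<ge> 0"
      by simp
    ultimately have "(LINT x|lborel. (norm (u x))\<^sup>2) = 0"
      by linarith
    moreover have "integrable lborel (\<lambda>x. (norm (u x))\<^sup>2)"
      using u(1) by (simp add: L2_def)
    ultimately have "AE x in lborel. (norm (u x))\<^sup>2 = 0"
      by (subst (asm) integral_nonneg_eq_0_iff_AE) auto
    then show False
      using u(2) by simp
  qed
qed

section \<open>Solitary waves as two-sided exponentials\<close>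

lemma profile_eq_two_sided_exp:
  "profile m \<omega> \<alpha> \<beta> = two_sided_exp (of_real (varkappa m \<omega>))
    (vector [of_real \<alpha>, of_real (\<beta> * mu m \<omega>)]) (vector [of_real \<beta>, of_real (\<alpha> * mu m \<omega>)])"
proof
  fix x
  have "exp (- of_real (varkappa m \<omega>) * of_real \<bar>x\<bar>) = complex_of_real (exp (- varkappa m \<omega> * \<bar>x\<bar>))"
    by (metis exp_of_real of_real_minus of_real_mult)
  then show "profile m \<omega> \<alpha> \<beta> x = two_sided_exp (of_real (varkappa m \<omega>))
    (vector [of_real \<alpha>, of_real (\<beta> * mu m \<omega>)]) (vector [of_real \<beta>, of_real (\<alpha> * mu m \<omega>)]) x"
    unfolding two_sided_exp_def
    by (simp only: vec2_eq_iff profile_def vector_2 scaleR_conv_of_real[where 'a=complex]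
        vector_scaleR_component vector_add_component vector_smult_component)
      (simp add: algebra_simps)
qed

lemma coupling_form_scale: "cmod c = 1 \<Longrightarrow> coupling_form \<epsilon> (c *s z) = coupling_form \<epsilon> z"
proof -
  assume "cmod c = 1"
  then have c: "cnj c * c = 1"
    by (metis complex_norm_square mult.commute of_real_1 power_one)
  have "(\<Sum>i\<in>UNIV. cnj ((c *s z) $ i) * (coupling \<epsilon> *v (c *s z)) $ i) =
      cnj c * c * (\<Sum>i\<in>UNIV. cnj (z $ i) * (coupling \<epsilon> *v z) $ i)"
    by (simp add: sum_2 coupling_component algebra_simps)
  then show ?thesis
    by (simp add: coupling_form_def c)
qed

text \<open>The phase exp(- i \<omega> t) drops out: its time derivative produces the energy
  \<omega>, and the quadratic form is phase invariant by \<open>coupling_form_scale\<close>. What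
  remains is algebra in \<open>A\<close> and \<open>B\<close>.\<close>

lemma solitary_wave_two_sided_exp:
  assumes k: "Re k > 0" and eq: "dirac_exp m (of_real \<omega>) k A B"
    and jump: "2 * B $ 2 = nonlin \<kappa> (coupling_form \<epsilon> A) * (A $ 1 + \<epsilon> * A $ 2)"
      "- 2 * B $ 1 = nonlin \<kappa> (coupling_form \<epsilon> A) * (\<epsilon> * A $ 1 - A $ 2)"
  shows "solitary_wave m \<kappa> \<epsilon> \<omega> (two_sided_exp k A B)"
  unfolding solitary_wave_def nld_solution_def
proof (intro allI conjI)
  fix t
  define c where "c = exp (- (\<i> * complex_of_real (\<omega> * t)))"
  have c: "cmod c = 1"
    by (simp add: c_def)
  \<comment> \<open>A zero second exponential is added so that the results on sums of two
    exponentials apply.\<close>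
  have eq_fun: "(\<lambda>x. c *s two_sided_exp k A B x) =
      (\<lambda>x. two_sided_exp k (c *s A) (c *s B) x + two_sided_exp k 0 0 x)"
    by (simp add: two_sided_exp_scale)
  define d where "d = (\<lambda>x. two_sided_exp k (- k *s (c *s B)) (- k *s (c *s A)) x
      + two_sided_exp k (- k *s 0) (- k *s 0) x)"
  have "H1_deriv (\<lambda>x. c *s two_sided_exp k A B x) d"
    unfolding eq_fun d_def by (rule H1_deriv_two_sided_exp_add[OF k k])
  moreover have "\<exists>p. ((\<lambda>s. exp (- (\<i> * complex_of_real (\<omega> * s))) *s two_sided_exp k A B x)
      has_vector_derivative p) (at t) \<and> \<i> *s p = dirac m (\<lambda>x. c *s two_sided_exp k A B x) d x" for x
  proof -
    have "((\<lambda>z. exp (- (\<i> * of_real \<omega> * z))) has_field_derivative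
        - (\<i> * of_real \<omega>) * exp (- (\<i> * of_real \<omega> * of_real t))) (at (of_real t))"
      by (auto intro!: derivative_eq_intros)
    then have "((\<lambda>s. exp (- (\<i> * of_real \<omega> * of_real s))) has_vector_derivative
        - (\<i> * of_real \<omega>) * exp (- (\<i> * of_real \<omega> * of_real t))) (at t)"
      by (rule has_vector_derivative_real_field)
    then have "((\<lambda>s. exp (- (\<i> * complex_of_real (\<omega> * s))) *s two_sided_exp k A B x)
        has_vector_derivative (- (\<i> * of_real \<omega>) * c) *s two_sided_exp k A B x) (at t)"
      unfolding c_def of_real_mult mult.assoc
      by (rule bounded_linear.has_vector_derivative[OF bounded_linear_vector_smult_left])
    moreover have "\<i> *s ((- (\<i> * of_real \<omega>) * c) *s two_sided_exp k A B x) =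
        dirac m (\<lambda>x. c *s two_sided_exp k A B x) d x"
    proof -
      have "d = two_sided_exp k (- k *s (c *s B)) (- k *s (c *s A))"
        by (simp add: d_def)
      moreover have "(\<lambda>x. c *s two_sided_exp k A B x) = two_sided_exp k (c *s A) (c *s B)"
        by (rule ext) (simp add: two_sided_exp_scale)
      ultimately show ?thesis
        using dirac_two_sided_exp[OF dirac_exp_scale[OF eq], of c x]
        by (simp only: two_sided_exp_scale) (simp add: vec2_eq_iff flip: mult.assoc)
    qed
    ultimately show ?thesis
      by blast
  qed
  ultimately show "\<exists>d. H1_deriv (\<lambda>x. exp (- (\<i> * complex_of_real (\<omega> * t))) *s two_sided_exp k A B x) d \<and>
      (AE x in lborel. \<exists>p. ((\<lambda>s. exp (- (\<i> * complex_of_real (\<omega> * s))) *s two_sided_exp k A B x)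
        has_vector_derivative p) (at t) \<and>
        \<i> *s p = dirac m (\<lambda>x. exp (- (\<i> * complex_of_real (\<omega> * t))) *s two_sided_exp k A B x) d x)"
    unfolding c_def by (intro exI[of _ d] conjI AE_I2) blast+
  have "\<i> *s (sigma2 *v (2 *\<^sub>R (c *s B)))
      - nonlin \<kappa> (coupling_form \<epsilon> A) *\<^sub>R (coupling \<epsilon> *v (c *s A)) =
      c *s (\<i> *s (sigma2 *v (2 *\<^sub>R B)) - nonlin \<kappa> (coupling_form \<epsilon> A) *\<^sub>R (coupling \<epsilon> *v A))"
    unfolding vec2_eq_iff vector_smult_component[of c] vector_minus_component i_sigma2_component
    unfolding vector_smult_component vector_scaleR_component coupling_component scaleR_conv_of_real[where 'a=complex]
    by (simp add: algebra_simps)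
  also have "\<i> *s (sigma2 *v (2 *\<^sub>R B)) - nonlin \<kappa> (coupling_form \<epsilon> A) *\<^sub>R (coupling \<epsilon> *v A) = 0"
    unfolding vec2_eq_iff vector_minus_component i_sigma2_component
    unfolding vector_scaleR_component coupling_component scaleR_conv_of_real[where 'a=complex]
    using jump by simp
  also have "c *s 0 = 0"
    by simp
  finally show "\<i> *s (sigma2 *v jump0 (\<lambda>x. exp (- (\<i> * complex_of_real (\<omega> * t))) *s two_sided_exp k A B x)) -
      nonlin \<kappa> (coupling_form \<epsilon> (mean0 (\<lambda>x. exp (- (\<i> * complex_of_real (\<omega> * t))) *s two_sided_exp k A B x))) *\<^sub>R
      (coupling \<epsilon> *v mean0 (\<lambda>x. exp (- (\<i> * complex_of_real (\<omega> * t))) *s two_sided_exp k A B x)) = 0"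
    unfolding c_def[symmetric] eq_fun jump0_two_sided_exp_add mean0_two_sided_exp_add
    by (simp add: coupling_form_scale c)
qed

section \<open>The fixed point equation\<close>

text \<open>Here \<open>e = \<epsilon>\<close> and \<open>u = \<mu>\<close>. These quantities stay regular as \<open>u \<rightarrow> 0\<close>; in terms of them
  \<open>f = 2 u wave_f\<close>, \<open>\<beta> = - u e wave_b \<alpha>\<close>, \<open>v = \<alpha> (wave_v1, e wave_v2)\<close>, \<open>\<tau> = \<alpha>\<^sup>2 wave_tau\<close> and
  \<open>g \<alpha>\<^sup>2 = 2 u wave_g\<close>.\<close>

definition wave_f :: "real \<Rightarrow> real \<Rightarrow> real" where
  "wave_f e u = 2 / (1 + u\<^sup>2 + sqrt ((1 - u\<^sup>2)\<^sup>2 - 4 * u\<^sup>2 * e\<^sup>2))"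

definition wave_b :: "real \<Rightarrow> real \<Rightarrow> real" where
  "wave_b e u = wave_f e u / (1 - u\<^sup>2 * wave_f e u)"

definition wave_v1 :: "real \<Rightarrow> real \<Rightarrow> real" where
  "wave_v1 e u = 1 - e\<^sup>2 * u\<^sup>2 * wave_b e u"

definition wave_v2 :: "real \<Rightarrow> real \<Rightarrow> real" where
  "wave_v2 e u = 1 + u\<^sup>2 * wave_b e u"

definition wave_tau :: "real \<Rightarrow> real \<Rightarrow> real" where
  "wave_tau e u = 1 - 2 * e\<^sup>2 * u\<^sup>2 * wave_b e u - e\<^sup>2 * u^4 * (wave_b e u)\<^sup>2"

definition wave_g :: "real \<Rightarrow> real \<Rightarrow> real \<Rightarrow> real" where
  "wave_g \<kappa> e u = \<kappa> * wave_f e u / wave_tau e u"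

text \<open>Since \<open>\<mu>\<^sup>2 = (m - \<omega>) / (m + \<omega>)\<close>, we have \<open>\<omega> = m freq \<mu>\<close>. The unknown \<open>N\<close> encodes \<open>\<zeta>\<close> by
  \<open>\<omega> + \<zeta> = m freq (u N)\<close>, and then \<open>m upper_freq\<close> is the energy \<open>3 \<omega> + \<zeta>\<close> of \<open>w\<close>, and \<open>xi\<close> is the
  ratio of the components of \<open>w\<close>. The branch of the root is the one for which \<open>w\<close> decays if
  \<open>Im \<zeta> < 0\<close>.\<close>

definition freq :: "complex \<Rightarrow> complex" where
  "freq z = (1 - z\<^sup>2) / (1 + z\<^sup>2)"

definition upper_freq :: "real \<Rightarrow> complex \<Rightarrow> complex" where
  "upper_freq u N = 2 * freq (of_real u) + freq (of_real u * N)"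

definition xi :: "real \<Rightarrow> complex \<Rightarrow> complex" where
  "xi u N = \<i> * csqrt ((upper_freq u N - 1) / (upper_freq u N + 1))"

text \<open>The jump conditions are solved for fixed \<open>l = v \<bullet> (u\<^sub>0 + w\<^sub>0) / \<alpha>\<close>, with \<open>u\<^sub>0\<close>, \<open>w\<^sub>0\<close> the means at \<open>0\<close>:
  \<open>mode_P\<close> and \<open>mode_Q\<close> come from Cramer's rule for \<open>w\<close> (with determinant \<open>mode_det\<close>),
  \<open>mode_M\<close> from the equation for the excited part of \<open>u\<close>, and \<open>l (1 - u mode_Z) = e mode_W\<close> is the
  remaining condition on \<open>l\<close>.\<close>

definition mode_M :: "real \<Rightarrow> real \<Rightarrow> complex \<Rightarrow> complex" where
  "mode_M e u N = N / (1 - of_real (u\<^sup>2 * wave_f e u) * N)"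

definition mode_W :: "real \<Rightarrow> real \<Rightarrow> complex \<Rightarrow> complex" where
  "mode_W e u N = of_real (wave_v2 e u) + of_real (u\<^sup>2 * wave_f e u * wave_v1 e u) * mode_M e u N"

definition mode_det :: "real \<Rightarrow> real \<Rightarrow> complex \<Rightarrow> complex" where
  "mode_det e u N = (xi u N - of_real (u * wave_f e u)) * (1 - of_real (u * wave_f e u) * xi u N)
     + of_real (u\<^sup>2 * (wave_f e u)\<^sup>2 * e\<^sup>2) * xi u N"

definition mode_P :: "real \<Rightarrow> real \<Rightarrow> complex \<Rightarrow> complex" where
  "mode_P e u N = (of_real (wave_v1 e u) * (1 - of_real (u * wave_f e u) * xi u N)
     - of_real (u * wave_f e u * e\<^sup>2 * wave_v2 e u) * xi u N) / mode_det e u N"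

definition mode_Q :: "real \<Rightarrow> real \<Rightarrow> complex \<Rightarrow> complex" where
  "mode_Q e u N = - of_real e * ((xi u N - of_real (u * wave_f e u)) * of_real (wave_v2 e u)
     + of_real (u * wave_f e u * wave_v1 e u)) / mode_det e u N"

definition mode_Z :: "real \<Rightarrow> real \<Rightarrow> real \<Rightarrow> complex \<Rightarrow> complex" where
  "mode_Z \<kappa> e u N = of_real (wave_g \<kappa> e u) *
      (of_real (wave_v1 e u) * mode_P e u N + of_real (e * wave_v2 e u) * xi u N * mode_Q e u N)
     + of_real (u * wave_g \<kappa> e u * (wave_v1 e u)\<^sup>2) * mode_M e u N"

definition mode_Psi :: "real \<Rightarrow> real \<Rightarrow> real \<Rightarrow> complex \<Rightarrow> complex" where
  "mode_Psi \<kappa> e u N = of_real (u\<^sup>2 * (wave_f e u)\<^sup>2) * mode_M e u N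
     + of_real (wave_g \<kappa> e u) * (mode_W e u N)\<^sup>2 / (1 - of_real u * mode_Z \<kappa> e u N)"

text \<open>This is \<open>Im mode_Psi / u\<close> on \<open>Im N = u y\<close>, in a form that extends continuously to \<open>u = 0\<close>.\<close>

definition mode_J :: "real \<Rightarrow> real \<Rightarrow> real \<Rightarrow> real \<Rightarrow> complex \<Rightarrow> real" where
  "mode_J \<kappa> e u y N = y * u\<^sup>2 * ((wave_f e u)\<^sup>2 + 2 * wave_g \<kappa> e u * wave_f e u * wave_v1 e u * Re (mode_W e u N))
       / (cmod (1 - of_real (u\<^sup>2 * wave_f e u) * N))\<^sup>2
     + Im (of_real (wave_g \<kappa> e u) * (mode_W e u N)\<^sup>2 * mode_Z \<kappa> e u N / (1 - of_real u * mode_Z \<kappa> e u N))"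

text \<open>After multiplication by the conjugate of the denominator the numerator is N - c |N|^2,
  and the subtracted term is real.\<close>

lemma Im_div_one_minus:
  assumes "1 - of_real c * N \<noteq> 0"
  shows "Im (N / (1 - of_real c * N)) = Im N / (cmod (1 - of_real c * N))\<^sup>2"
  unfolding complex_div_cnj[of N] by (simp add: algebra_simps)

text \<open>Every contribution carries a factor u. For \<open>mode_M\<close> and the square of
  \<open>mode_W\<close> it comes from Im N = u y; in the quotient it comes from G W^2 / (1 - u Z) =
  G W^2 + u G W^2 Z / (1 - u Z).\<close>

lemma Im_mode_Psi:
  assumes "Im N = u * y" "1 - of_real (u\<^sup>2 * wave_f e u) * N \<noteq> 0" "1 - of_real u * mode_Z \<kappa> e u N \<noteq> 0"
  shows "Im (mode_Psi \<kappa> e u N) = u * mode_J \<kappa> e u y N"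
proof -
  have M: "Im (mode_M e u N) = u * y / (cmod (1 - of_real (u\<^sup>2 * wave_f e u) * N))\<^sup>2"
    unfolding mode_M_def by (subst Im_div_one_minus[OF assms(2)]) (simp add: assms(1))
  have W: "Im ((mode_W e u N)\<^sup>2) = 2 * Re (mode_W e u N) * (u\<^sup>2 * wave_f e u * wave_v1 e u * Im (mode_M e u N))"
    by (simp add: Im_power2 mode_W_def)
  have Im_of_real: "Im (of_real r * z) = r * Im z" for r z
    by simp
  have "mode_Psi \<kappa> e u N = of_real (u\<^sup>2 * (wave_f e u)\<^sup>2) * mode_M e u N
     + of_real (wave_g \<kappa> e u) * (mode_W e u N)\<^sup>2
     + of_real u * (of_real (wave_g \<kappa> e u) * (mode_W e u N)\<^sup>2 * mode_Z \<kappa> e u N / (1 - of_real u * mode_Z \<kappa> e u N))"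
    using assms(3) unfolding mode_Psi_def by (simp add: field_simps)
  then have "Im (mode_Psi \<kappa> e u N) = u\<^sup>2 * (wave_f e u)\<^sup>2 * Im (mode_M e u N)
     + wave_g \<kappa> e u * Im ((mode_W e u N)\<^sup>2)
     + u * Im (of_real (wave_g \<kappa> e u) * (mode_W e u N)\<^sup>2 * mode_Z \<kappa> e u N / (1 - of_real u * mode_Z \<kappa> e u N))"
    using Im_of_real by (simp only: plus_complex.sel)
  then show ?thesis
    unfolding W M mode_J_def by (simp add: algebra_simps add_divide_distrib power2_eq_square)
qed

section \<open>Limits as \<epsilon> and \<mu> tend to 0 and N tends to 1\<close>

context
  fixes Fl :: "'a filter" and e u :: "'a \<Rightarrow> real" and \<kappa> :: real
  assumes e: "(e \<longlongrightarrow> 0) Fl" and u: "(u \<longlongrightarrow> 0) Fl"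
begin

text \<open>The filter is arbitrary so that this limit and the following ones can be taken jointly
  in all parameters, which makes the bounds derived from them uniform.\<close>

lemma tendsto_wave_f: "((\<lambda>t. wave_f (e t) (u t)) \<longlongrightarrow> 1) Fl"
  unfolding wave_f_def by (rule tendsto_eq_intros e u refl | simp)+

lemma tendsto_wave_b: "((\<lambda>t. wave_b (e t) (u t)) \<longlongrightarrow> 1) Fl"
  unfolding wave_b_def by (rule tendsto_eq_intros tendsto_wave_f e u refl | simp)+

lemma tendsto_wave_v1: "((\<lambda>t. wave_v1 (e t) (u t)) \<longlongrightarrow> 1) Fl"
  unfolding wave_v1_def by (rule tendsto_eq_intros tendsto_wave_b e u refl | simp)+

lemma tendsto_wave_v2: "((\<lambda>t. wave_v2 (e t) (u t)) \<longlongrightarrow> 1) Fl"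
  unfolding wave_v2_def by (rule tendsto_eq_intros tendsto_wave_b e u refl | simp)+

lemma tendsto_wave_tau: "((\<lambda>t. wave_tau (e t) (u t)) \<longlongrightarrow> 1) Fl"
  unfolding wave_tau_def by (rule tendsto_eq_intros tendsto_wave_b e u refl | simp)+

lemma tendsto_wave_g: "((\<lambda>t. wave_g \<kappa> (e t) (u t)) \<longlongrightarrow> \<kappa>) Fl"
  unfolding wave_g_def by (rule tendsto_eq_intros tendsto_wave_f tendsto_wave_tau e u refl | simp)+

context
  fixes N :: "'a \<Rightarrow> complex"
  assumes N: "(N \<longlongrightarrow> 1) Fl"
begin

lemma tendsto_upper_freq: "((\<lambda>t. upper_freq (u t) (N t)) \<longlongrightarrow> 3) Fl"
  unfolding upper_freq_def freq_def by (rule tendsto_eq_intros u N refl | simp)+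

text \<open>In units of m the energy of w tends to 3, so the radicand tends to (3 - 1) / (3 + 1) =
  1/2, away from the branch cut. The limit of \<open>xi\<close> is imaginary: to leading order w
  oscillates instead of decaying.\<close>

lemma tendsto_xi: "((\<lambda>t. xi (u t) (N t)) \<longlongrightarrow> \<i> * of_real (sqrt (1/2))) Fl"
proof -
  have "((\<lambda>t. (upper_freq (u t) (N t) - 1) / (upper_freq (u t) (N t) + 1)) \<longlongrightarrow> 1/2) Fl"
    by (rule tendsto_eq_intros tendsto_upper_freq refl | simp)+
  moreover have "isCont csqrt (1/2)"
    by (rule continuous_at_csqrt) (simp add: complex_nonpos_Reals_iff)
  ultimately have "((\<lambda>t. csqrt ((upper_freq (u t) (N t) - 1) / (upper_freq (u t) (N t) + 1))) \<longlongrightarrow> csqrt (1/2)) Fl"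
    by (rule isCont_tendsto_compose[rotated])
  moreover have "csqrt (1/2) = of_real (sqrt (1/2))"
    by (simp only: of_real_sqrt) simp
  ultimately show ?thesis
    unfolding xi_def by (auto intro!: tendsto_mult)
qed

lemma tendsto_mode_M: "((\<lambda>t. mode_M (e t) (u t) (N t)) \<longlongrightarrow> 1) Fl"
  unfolding mode_M_def by (rule tendsto_eq_intros tendsto_wave_f u N refl | simp)+

lemma tendsto_mode_W: "((\<lambda>t. mode_W (e t) (u t) (N t)) \<longlongrightarrow> 1) Fl"
  unfolding mode_W_def
  by (rule tendsto_eq_intros tendsto_wave_f tendsto_wave_v1 tendsto_wave_v2 tendsto_mode_M u refl | simp)+

lemma tendsto_mode_det: "((\<lambda>t. mode_det (e t) (u t) (N t)) \<longlongrightarrow> \<i> * of_real (sqrt (1/2))) Fl"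
  unfolding mode_det_def
  by (rule tendsto_eq_intros tendsto_wave_f tendsto_xi e u refl | simp)+

lemma tendsto_mode_P: "((\<lambda>t. mode_P (e t) (u t) (N t)) \<longlongrightarrow> 1 / (\<i> * of_real (sqrt (1/2)))) Fl"
  unfolding mode_P_def
  by (rule tendsto_eq_intros tendsto_wave_f tendsto_wave_v1 tendsto_wave_v2 tendsto_xi tendsto_mode_det e u refl | simp)+

lemma tendsto_mode_Q: "((\<lambda>t. mode_Q (e t) (u t) (N t)) \<longlongrightarrow> 0) Fl"
  unfolding mode_Q_def
  by (rule tendsto_eq_intros tendsto_wave_f tendsto_wave_v1 tendsto_wave_v2 tendsto_xi tendsto_mode_det e u refl | simp)+

lemma tendsto_mode_Z: "((\<lambda>t. mode_Z \<kappa> (e t) (u t) (N t)) \<longlongrightarrow> of_real \<kappa> / (\<i> * of_real (sqrt (1/2)))) Fl"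
  unfolding mode_Z_def
  by (rule tendsto_eq_intros tendsto_wave_g tendsto_wave_v1 tendsto_wave_v2 tendsto_xi
      tendsto_mode_P tendsto_mode_Q tendsto_mode_M e u refl | simp)+

lemma tendsto_mode_Psi: "((\<lambda>t. mode_Psi \<kappa> (e t) (u t) (N t)) \<longlongrightarrow> of_real \<kappa>) Fl"
  unfolding mode_Psi_def
  by (rule tendsto_eq_intros tendsto_wave_f tendsto_wave_g tendsto_mode_W tendsto_mode_Z tendsto_mode_M u refl | simp)+

text \<open>The first summand of \<open>mode_J\<close> vanishes in the limit through y u^2. The
  second tends to the imaginary part of \<kappa>^2 / (i / sqrt 2), which is negative because
  \<open>xi\<close> tends to i times a positive number. This sign produces the instability.\<close>

lemma tendsto_mode_J:
  assumes y: "(y \<longlongrightarrow> 0) Fl"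
  shows "((\<lambda>t. mode_J \<kappa> (e t) (u t) (y t) (N t)) \<longlongrightarrow> - (sqrt 2 * \<kappa>\<^sup>2)) Fl"
proof -
  have "((\<lambda>t. mode_J \<kappa> (e t) (u t) (y t) (N t)) \<longlongrightarrow> Im (of_real \<kappa> * (of_real \<kappa> / (\<i> * of_real (sqrt (1/2)))))) Fl"
    unfolding mode_J_def
    by (rule tendsto_eq_intros tendsto_wave_f tendsto_wave_g tendsto_wave_v1 tendsto_mode_W
        tendsto_mode_Z u N y refl | simp)+
  moreover have "Im (of_real \<kappa> * (of_real \<kappa> / (\<i> * of_real (sqrt (1/2))))) = - (sqrt 2 * \<kappa>\<^sup>2)"
  proof -
    have "of_real \<kappa> * (of_real \<kappa> / (\<i> * complex_of_real (sqrt (1/2)))) = - \<i> * of_real (\<kappa>\<^sup>2 * sqrt 2)"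
      by (simp add: real_sqrt_divide power2_eq_square field_simps)
    then show ?thesis
      by (simp only:) simp
  qed
  ultimately show ?thesis
    by simp
qed

end

end

section \<open>Admissible parameters\<close>

lemma wave_f_quadratic:
  assumes "0 \<le> (1 - u\<^sup>2)\<^sup>2 - 4 * u\<^sup>2 * e\<^sup>2"
  shows "(1 - u\<^sup>2 * wave_f e u) * (wave_f e u - 1) = e\<^sup>2 * u\<^sup>2 * (wave_f e u)\<^sup>2"
proof -
  define s where "s = sqrt ((1 - u\<^sup>2)\<^sup>2 - 4 * u\<^sup>2 * e\<^sup>2)"
  define F where "F = wave_f e u"
  have s: "s \<ge> 0" "s\<^sup>2 = (1 - u\<^sup>2)\<^sup>2 - 4 * u\<^sup>2 * e\<^sup>2"
    using assms by (auto simp: s_def)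
  then have "1 + u\<^sup>2 + s > 0"
    by (simp add: add_pos_nonneg)
  then have F: "F * (1 + u\<^sup>2 + s) = 2"
    unfolding F_def wave_f_def s_def[symmetric] by (metis less_irrefl nonzero_eq_divide_eq)
  \<comment> \<open>Isolating the root \<open>s\<close> and squaring turns the closed form of
    \<open>wave_f\<close> into its quadratic equation.\<close>
  then have "s * F = 2 - (1 + u\<^sup>2) * F"
    by (simp add: algebra_simps)
  then have "s\<^sup>2 * F\<^sup>2 = (2 - (1 + u\<^sup>2) * F)\<^sup>2"
    by (metis power_mult_distrib)
  then have "(1 - u\<^sup>2 * F) * (F - 1) = e\<^sup>2 * u\<^sup>2 * F\<^sup>2"
    unfolding s(2) by algebra
  then show ?thesis
    by (simp add: F_def)
qed

text \<open>All conditions are strict inequalities or state that something is nonzero, and they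
  survive in the limit (e, u, x, y) -> (0, 0, 1, 0), hence hold near that point. They make
  denominators nonzero, keep the radicand in \<open>xi\<close> off the branch cut, make the first
  mode decay and supply the bounds for Brouwer's theorem.\<close>

definition admissible :: "real \<Rightarrow> real \<Rightarrow> real \<Rightarrow> real \<Rightarrow> real \<Rightarrow> bool" where
  "admissible \<kappa> e u x y \<longleftrightarrow> (let N = Complex x (u * y) in
    0 < (1 - u\<^sup>2)\<^sup>2 - 4 * u\<^sup>2 * e\<^sup>2 \<and> 0 < wave_f e u \<and> u\<^sup>2 * wave_f e u < 1 \<and> 0 < wave_tau e u \<and>
    u\<^sup>2 * (wave_f e u)\<^sup>2 / (1 - u\<^sup>2 * wave_f e u) < 1 \<and>
    1 - of_real (u\<^sup>2 * wave_f e u) * N \<noteq> 0 \<and> 1 + (of_real u * N)\<^sup>2 \<noteq> 0 \<and>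
    0 < Re (N / (1 + (of_real u * N)\<^sup>2)) \<and>
    0 < Re (upper_freq u N) \<and> 0 < Re ((upper_freq u N - 1) / (upper_freq u N + 1)) \<and>
    mode_det e u N \<noteq> 0 \<and> 1 - of_real u * mode_Z \<kappa> e u N \<noteq> 0 \<and>
    cmod (mode_Psi \<kappa> e u N) < \<kappa> + 1 \<and>
    - (2 * \<kappa>\<^sup>2) < mode_J \<kappa> e u y N \<and> mode_J \<kappa> e u y N < 0 \<and> 0 < x)"

lemma eventually_admissible:
  assumes \<kappa>: "\<kappa> > 0" and e: "(e \<longlongrightarrow> 0) Fl" and u: "(u \<longlongrightarrow> 0) Fl" and x: "(x \<longlongrightarrow> 1) Fl" and y: "(y \<longlongrightarrow> 0) Fl"
  shows "eventually (\<lambda>t. admissible \<kappa> (e t) (u t) (x t) (y t)) Fl"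
proof -
  define N where "N = (\<lambda>t. Complex (x t) (u t * y t))"
  have N: "(N \<longlongrightarrow> 1) Fl"
    unfolding N_def one_complex.code
    by (rule tendsto_Complex tendsto_eq_intros x u y refl | simp)+
  note lims = tendsto_wave_f[OF e u] tendsto_wave_tau[OF e u]
    tendsto_upper_freq[OF e u N] tendsto_mode_det[OF e u N] tendsto_mode_Z[OF e u N, where \<kappa>=\<kappa>]
    tendsto_mode_Psi[OF e u N, where \<kappa>=\<kappa>] tendsto_mode_J[OF e u N y, where \<kappa>=\<kappa>]
  have F: "((\<lambda>t. (1 - (u t)\<^sup>2)\<^sup>2 - 4 * (u t)\<^sup>2 * (e t)\<^sup>2) \<longlongrightarrow> 1) Fl"
    "((\<lambda>t. (u t)\<^sup>2 * wave_f (e t) (u t)) \<longlongrightarrow> 0) Fl"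
    "((\<lambda>t. (u t)\<^sup>2 * (wave_f (e t) (u t))\<^sup>2 / (1 - (u t)\<^sup>2 * wave_f (e t) (u t))) \<longlongrightarrow> 0) Fl"
    "((\<lambda>t. 1 - of_real ((u t)\<^sup>2 * wave_f (e t) (u t)) * N t) \<longlongrightarrow> 1) Fl"
    "((\<lambda>t. 1 + (of_real (u t) * N t)\<^sup>2) \<longlongrightarrow> 1) Fl"
    "((\<lambda>t. Re (N t / (1 + (of_real (u t) * N t)\<^sup>2))) \<longlongrightarrow> 1) Fl"
    "((\<lambda>t. Re (upper_freq (u t) (N t))) \<longlongrightarrow> 3) Fl"
    "((\<lambda>t. Re ((upper_freq (u t) (N t) - 1) / (upper_freq (u t) (N t) + 1))) \<longlongrightarrow> 1/2) Fl"
    "((\<lambda>t. 1 - of_real (u t) * mode_Z \<kappa> (e t) (u t) (N t)) \<longlongrightarrow> 1) Fl"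
    "((\<lambda>t. cmod (mode_Psi \<kappa> (e t) (u t) (N t))) \<longlongrightarrow> \<kappa>) Fl"
    by (insert \<kappa>, (rule tendsto_eq_intros lims N e u refl | simp)+)
  \<comment> \<open>The limit - sqrt 2 \<kappa>^2 of \<open>mode_J\<close> lies strictly between - 2
    \<kappa>^2 and 0, which leaves room for both bounds.\<close>
  have "sqrt 2 * \<kappa>\<^sup>2 < 2 * \<kappa>\<^sup>2" "sqrt 2 * \<kappa>\<^sup>2 > 0"
    using \<kappa> real_sqrt_less_iff[of 2 4] by auto
  then have J: "- (2 * \<kappa>\<^sup>2) < - (sqrt 2 * \<kappa>\<^sup>2)" "- (sqrt 2 * \<kappa>\<^sup>2) < 0"
    by auto
  have Nt: "Complex (x t) (u t * y t) = N t" for t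
    by (simp add: N_def)
  show ?thesis
    unfolding admissible_def Let_def Nt
    by (intro eventually_conj order_tendstoD(1)[OF F(1)] order_tendstoD(1)[OF lims(1)]
        order_tendstoD(2)[OF F(2)] order_tendstoD(1)[OF lims(2)] order_tendstoD(2)[OF F(3)]
        tendsto_imp_eventually_ne[OF F(4)] tendsto_imp_eventually_ne[OF F(5)]
        order_tendstoD(1)[OF F(6)] order_tendstoD(1)[OF F(7)] order_tendstoD(1)[OF F(8)]
        tendsto_imp_eventually_ne[OF lims(4)] tendsto_imp_eventually_ne[OF F(9)]
        order_tendstoD(2)[OF F(10)] order_tendstoD(1)[OF lims(7)] order_tendstoD(2)[OF lims(7)]
        order_tendstoD(1)[OF x] J) auto
qed

lemma ex_admissible_box:
  assumes "\<kappa> > 0"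
  obtains \<delta> where "0 < \<delta>" "\<delta> < 1"
    "\<And>e u x y. \<bar>e\<bar> \<le> \<delta> \<Longrightarrow> \<bar>u\<bar> \<le> \<delta> \<Longrightarrow> \<bar>x - 1\<bar> \<le> \<delta> \<Longrightarrow> \<bar>y\<bar> \<le> \<delta> \<Longrightarrow> admissible \<kappa> e u x y"
proof -
  let ?p = "(0, 0, 1, 0) :: real \<times> real \<times> real \<times> real"
  have id: "((\<lambda>t. t) \<longlongrightarrow> ?p) (nhds ?p)"
    by (rule filterlim_ident)
  have "((\<lambda>t. fst t) \<longlongrightarrow> 0) (nhds ?p)" "((\<lambda>t. fst (snd t)) \<longlongrightarrow> 0) (nhds ?p)"
      "((\<lambda>t. fst (snd (snd t))) \<longlongrightarrow> 1) (nhds ?p)" "((\<lambda>t. snd (snd (snd t))) \<longlongrightarrow> 0) (nhds ?p)"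
    by (rule tendsto_eq_intros id refl | simp)+
  from eventually_admissible[OF assms this]
  obtain d where d: "d > 0" "\<And>t. dist t ?p < d \<Longrightarrow>
      admissible \<kappa> (fst t) (fst (snd t)) (fst (snd (snd t))) (snd (snd (snd t)))"
    unfolding eventually_nhds_metric by blast
  \<comment> \<open>Four coordinates of size at most d / 5 stay within distance d, and 1/2 ensures
    \<delta> < 1.\<close>
  define \<delta> where "\<delta> = min (1/2) (d/5)"
  have "admissible \<kappa> e u x y" if "\<bar>e\<bar> \<le> \<delta>" "\<bar>u\<bar> \<le> \<delta>" "\<bar>x - 1\<bar> \<le> \<delta>" "\<bar>y\<bar> \<le> \<delta>" for e u x y
  proof -
    have "dist (e, u, x, y) ?p = norm (e, u, x - 1, y)"
      by (simp add: dist_norm)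
    also have "\<dots> \<le> \<bar>e\<bar> + (\<bar>u\<bar> + (\<bar>x - 1\<bar> + \<bar>y\<bar>))"
      by (intro order.trans[OF norm_Pair_le] add_mono) auto
    also have "\<dots> < d"
      using that d(1) by (simp add: \<delta>_def)
    finally show ?thesis
      using d(2) by force
  qed
  moreover have "0 < \<delta>" "\<delta> < 1"
    using d(1) by (auto simp: \<delta>_def)
  ultimately show ?thesis
    using that by blast
qed

text \<open>Besides zeros of denominators, only the branch cut of \<open>csqrt\<close> could break
  continuity; a radicand of positive real part stays off the cut.\<close>

lemma continuous_on_mode_Psi:
  assumes "\<And>N. N \<in> S \<Longrightarrow> \<exists>x y. N = Complex x (u * y) \<and> admissible \<kappa> e u x y"
  shows "continuous_on S (mode_Psi \<kappa> e u)"
proof -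
  have nz: "1 - of_real (u\<^sup>2 * wave_f e u) * N \<noteq> 0" "1 + (of_real u * N)\<^sup>2 \<noteq> 0"
      "upper_freq u N + 1 \<noteq> 0" "(upper_freq u N - 1) / (upper_freq u N + 1) \<notin> \<real>\<^sub>\<le>\<^sub>0"
      "mode_det e u N \<noteq> 0" "1 - of_real u * mode_Z \<kappa> e u N \<noteq> 0" if "N \<in> S" for N
  proof -
    obtain x y where "N = Complex x (u * y)" "admissible \<kappa> e u x y"
      using assms[OF \<open>N \<in> S\<close>] by blast
    then have adm: "1 - of_real (u\<^sup>2 * wave_f e u) * N \<noteq> 0" "1 + (of_real u * N)\<^sup>2 \<noteq> 0"
      "0 < Re (upper_freq u N)" "0 < Re ((upper_freq u N - 1) / (upper_freq u N + 1))"
      "mode_det e u N \<noteq> 0" "1 - of_real u * mode_Z \<kappa> e u N \<noteq> 0"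
      unfolding admissible_def Let_def by blast+
    then show "1 - of_real (u\<^sup>2 * wave_f e u) * N \<noteq> 0" "1 + (of_real u * N)\<^sup>2 \<noteq> 0"
      "mode_det e u N \<noteq> 0" "1 - of_real u * mode_Z \<kappa> e u N \<noteq> 0"
      by blast+
    have "Re (upper_freq u N + 1) \<noteq> 0"
      using adm(3) by simp
    then show "upper_freq u N + 1 \<noteq> 0"
      by (metis zero_complex.sel(1))
    show "(upper_freq u N - 1) / (upper_freq u N + 1) \<notin> \<real>\<^sub>\<le>\<^sub>0"
      using adm(4) by (meson complex_nonpos_Reals_iff not_le)
  qed
  have up: "continuous_on S (upper_freq u)"
    unfolding upper_freq_def[abs_def] freq_def by (intro continuous_intros) (use nz in auto)
  have "continuous_on S (\<lambda>N. csqrt ((upper_freq u N - 1) / (upper_freq u N + 1)))"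
    by (rule continuous_on_compose2[OF continuous_on_csqrt]) (use nz in \<open>auto intro!: continuous_intros up\<close>)
  then have xi: "continuous_on S (xi u)"
    unfolding xi_def[abs_def] by (intro continuous_intros)
  have M: "continuous_on S (mode_M e u)"
    unfolding mode_M_def[abs_def] by (intro continuous_intros) (use nz in auto)
  have W: "continuous_on S (mode_W e u)"
    unfolding mode_W_def[abs_def] by (intro continuous_intros M)
  have det: "continuous_on S (mode_det e u)"
    unfolding mode_det_def[abs_def] by (intro continuous_intros xi)
  have P: "continuous_on S (mode_P e u)"
    unfolding mode_P_def[abs_def] by (intro continuous_intros xi det) (use nz in auto)
  have Q: "continuous_on S (mode_Q e u)"
    unfolding mode_Q_def[abs_def] by (intro continuous_intros xi det) (use nz in auto)
  have Z: "continuous_on S (mode_Z \<kappa> e u)"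
    unfolding mode_Z_def[abs_def] by (intro continuous_intros xi P Q M)
  show ?thesis
    unfolding mode_Psi_def[abs_def] by (intro continuous_intros M W Z) (use nz in auto)
qed

text \<open>Brouwer's theorem is applied to \<open>T\<close> on the box \<open>S\<close>. The bound
  on T N - 1 controls the real part. The imaginary part of T N is - u e^2 J with J between - 2
  \<kappa>^2 and 0, so it stays in the box, and for e nonzero it pushes the fixed point off the real
  axis.\<close>

lemma ex_fixed_point:
  assumes \<delta>: "0 < \<delta>" "\<And>x y. \<bar>x - 1\<bar> \<le> \<delta> \<Longrightarrow> \<bar>y\<bar> \<le> \<delta> \<Longrightarrow> admissible \<kappa> e u x y"
    and u: "u > 0" and e: "e\<^sup>2 * (\<kappa> + 2) \<le> \<delta>" "e\<^sup>2 * (2 * \<kappa>\<^sup>2) \<le> \<delta>"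
  shows "\<exists>x y. admissible \<kappa> e u x y \<and> (e \<noteq> 0 \<longrightarrow> y > 0) \<and> cmod (Complex x (u * y) - 1) \<le> e\<^sup>2 * (\<kappa> + 2) \<and>
    Complex x (u * y) = of_real (wave_f e u) - of_real (e\<^sup>2) * mode_Psi \<kappa> e u (Complex x (u * y))"
proof -
  define S where "S = cbox (Complex (1 - \<delta>) 0) (Complex (1 + \<delta>) (u * \<delta>))"
  define T where "T = (\<lambda>N. of_real (wave_f e u) - of_real (e\<^sup>2) * mode_Psi \<kappa> e u N)"
  have S: "\<exists>x y. N = Complex x (u * y) \<and> \<bar>x - 1\<bar> \<le> \<delta> \<and> 0 \<le> y \<and> y \<le> \<delta>" if "N \<in> S" for N
    using that u by (intro exI[of _ "Re N"] exI[of _ "Im N / u"])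
      (auto simp: S_def in_cbox_complex_iff field_simps)
  have adm0: "admissible \<kappa> e u 1 0"
    using \<delta> by simp
  have close: "cmod (T N - 1) \<le> e\<^sup>2 * (\<kappa> + 2)" and ImT: "Im (T N) = u * (e\<^sup>2 * - mode_J \<kappa> e u y N)"
    if "N = Complex x (u * y)" "admissible \<kappa> e u x y" for N x y
  proof -
    \<comment> \<open>By \<open>wave_f_quadratic\<close>, \<open>wave_f e u - 1\<close> equals
      \<open>e\<^sup>2 * H\<close>, so all of T N - 1 is of order e^2.\<close>
    define H where "H = u\<^sup>2 * (wave_f e u)\<^sup>2 / (1 - u\<^sup>2 * wave_f e u)"
    have H: "0 \<le> H" "H < 1" and "wave_f e u = 1 + e\<^sup>2 * H"
      using adm0 wave_f_quadratic[of u e] unfolding admissible_def Let_def H_def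
      by (auto simp: field_simps)
    then have T: "T N - 1 = of_real (e\<^sup>2) * (of_real H - mode_Psi \<kappa> e u N)"
      unfolding T_def right_diff_distrib by simp
    have "cmod (of_real H - mode_Psi \<kappa> e u N) \<le> cmod (of_real H) + cmod (mode_Psi \<kappa> e u N)"
      by (rule norm_triangle_ineq4)
    also have "\<dots> \<le> 1 + (\<kappa> + 1)"
      using that H unfolding admissible_def Let_def by (intro add_mono) auto
    finally show "cmod (T N - 1) \<le> e\<^sup>2 * (\<kappa> + 2)"
      unfolding T norm_mult by (intro mult_mono) (auto simp: norm_power)
    have "Im (mode_Psi \<kappa> e u N) = u * mode_J \<kappa> e u y N"
      using that unfolding admissible_def Let_def by (intro Im_mode_Psi) auto
    then show "Im (T N) = u * (e\<^sup>2 * - mode_J \<kappa> e u y N)"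
      by (simp add: T_def)
  qed
  have "T \<in> S \<rightarrow> S"
  proof
    fix N assume "N \<in> S"
    then obtain x y where N: "N = Complex x (u * y)" "admissible \<kappa> e u x y"
      using S \<delta>(2) by (metis abs_of_nonneg)
    have "\<bar>Re (T N) - 1\<bar> \<le> \<delta>"
      using abs_Re_le_cmod[of "T N - 1"] close[OF N] e(1) by simp
    moreover have "- (2 * \<kappa>\<^sup>2) < mode_J \<kappa> e u y N" "mode_J \<kappa> e u y N < 0"
      using N unfolding admissible_def Let_def by auto
    then have "0 \<le> e\<^sup>2 * - mode_J \<kappa> e u y N" "e\<^sup>2 * - mode_J \<kappa> e u y N \<le> e\<^sup>2 * (2 * \<kappa>\<^sup>2)"
      by (intro mult_nonneg_nonneg mult_left_mono; simp)+
    then have "0 \<le> Im (T N)" "Im (T N) \<le> u * \<delta>"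
      unfolding ImT[OF N] using u e(2)
      by (auto intro: mult_nonneg_nonneg[of u "e\<^sup>2 * - mode_J \<kappa> e u y N", simplified]
        mult_left_mono[of "e\<^sup>2 * - mode_J \<kappa> e u y N" \<delta> u, simplified] simp: mult_nonneg_nonpos)
    ultimately show "T N \<in> S"
      by (auto simp: S_def in_cbox_complex_iff)
  qed
  moreover have "continuous_on S T"
    unfolding T_def using S \<delta>(2)
    by (intro continuous_intros continuous_on_mode_Psi) (metis abs_of_nonneg)
  moreover have "1 \<in> S"
    using \<delta>(1) u by (simp add: S_def in_cbox_complex_iff)
  then have "S \<noteq> {}"
    by blast
  ultimately obtain N where N: "N \<in> S" "T N = N"
    using brouwer[of S T] compact_cbox convex_box(1) by (metis S_def)
  then obtain x y where xy: "N = Complex x (u * y)" "admissible \<kappa> e u x y"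
    using S \<delta>(2) by (metis abs_of_nonneg)
  have "y > 0" if "e \<noteq> 0"
  proof -
    have "u * y = u * (e\<^sup>2 * - mode_J \<kappa> e u y N)"
      using ImT[OF xy] N(2) xy(1) by simp
    then have "y = e\<^sup>2 * - mode_J \<kappa> e u y N"
      using u by (metis less_irrefl mult_left_cancel)
    also have "\<dots> > 0"
      using xy that unfolding admissible_def Let_def by (simp add: mult_pos_neg)
    finally show ?thesis .
  qed
  moreover have "cmod (N - 1) \<le> e\<^sup>2 * (\<kappa> + 2)"
    using close[OF xy] N(2) by simp
  moreover have "N = of_real (wave_f e u) - of_real (e\<^sup>2) * mode_Psi \<kappa> e u N"
    using N(2)[symmetric] by (simp only: T_def)
  ultimately show ?thesis
    using xy by blast
qed

section \<open>Solving the jump conditions\<close>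

text \<open>This is the linear system for w with the common factor u \<open>wave_g\<close> l divided
  out. Cramer's formulas are verified after multiplication by \<open>mode_det\<close>.\<close>

lemma mode_PQ:
  assumes "mode_det e u N \<noteq> 0"
  shows "mode_P e u N * (xi u N - of_real (u * wave_f e u)) =
      of_real (u * wave_f e u * e) * xi u N * mode_Q e u N + of_real (wave_v1 e u)"
    and "- mode_Q e u N * (1 - of_real (u * wave_f e u) * xi u N) =
      of_real (u * wave_f e u * e) * mode_P e u N + of_real (e * wave_v2 e u)"
proof -
  define D X F a b U E where "D = mode_det e u N" and "X = xi u N"
    and "F = complex_of_real (wave_f e u)" and "a = complex_of_real (wave_v1 e u)"
    and "b = complex_of_real (wave_v2 e u)" and "U = complex_of_real u" and "E = complex_of_real e"
  note defs = X_def[symmetric] F_def[symmetric] a_def[symmetric] b_def[symmetric] U_def[symmetric] E_def[symmetric]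
  have D: "D = (X - U * F) * (1 - U * F * X) + U\<^sup>2 * F\<^sup>2 * E\<^sup>2 * X" "D \<noteq> 0"
    using assms by (simp_all add: D_def mode_det_def defs)
  have P: "D * mode_P e u N = a * (1 - U * F * X) - U * F * E\<^sup>2 * b * X"
    using assms by (simp add: D_def mode_P_def defs)
  have Q: "D * mode_Q e u N = - E * ((X - U * F) * b + U * F * a)"
    using assms by (simp add: D_def mode_Q_def defs)
  have "D * (mode_P e u N * (X - U * F)) = D * (U * F * E * X * mode_Q e u N + a)"
    using P Q D(1) by algebra
  then show "mode_P e u N * (xi u N - of_real (u * wave_f e u)) =
      of_real (u * wave_f e u * e) * xi u N * mode_Q e u N + of_real (wave_v1 e u)"
    using D(2) by (simp add: defs)
  have "D * (- mode_Q e u N * (1 - U * F * X)) = D * (U * F * E * mode_P e u N + E * b)"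
    using P Q D(1) by algebra
  then show "- mode_Q e u N * (1 - of_real (u * wave_f e u) * xi u N) =
      of_real (u * wave_f e u * e) * mode_P e u N + of_real (e * wave_v2 e u)"
    using D(2) by (simp only: mult_cancel_left) (simp add: defs)
qed

text \<open>The first equation defines l. The others are the jump conditions for one mode with mean
  (u N q, 1) and half jump (u N, q), and for the other with mean (P, xi Q) and half jump (Q, xi P),
  after common factors are cancelled. All but the third determine l, q, P and Q; the third then
  follows from the fixed point equation.\<close>

lemma mode_system:
  assumes det: "mode_det e u N \<noteq> 0" and den: "1 - of_real (u\<^sup>2 * wave_f e u) * N \<noteq> 0"
    and Z: "1 - of_real u * mode_Z \<kappa> e u N \<noteq> 0"
    and fp: "N = of_real (wave_f e u) - of_real (e\<^sup>2) * mode_Psi \<kappa> e u N"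
  obtains q P Q l :: complex where
    "l = of_real (wave_v1 e u) * (of_real u * N * q + P) + of_real (e * wave_v2 e u) * (1 + xi u N * Q)"
    "q = of_real (u * wave_f e u) * (of_real u * N * q + of_real e) + of_real (u * wave_g \<kappa> e u * wave_v1 e u) * l"
    "- N = of_real (wave_f e u) * (of_real (e * u) * N * q - 1) + of_real (wave_g \<kappa> e u * e * wave_v2 e u) * l"
    "xi u N * P = of_real (u * wave_f e u) * (P + of_real e * (xi u N * Q)) + of_real (u * wave_g \<kappa> e u * wave_v1 e u) * l"
    "- Q = of_real (u * wave_f e u) * (of_real e * P - xi u N * Q) + of_real (u * wave_g \<kappa> e u * e * wave_v2 e u) * l"
proof -
  define X F a b U E G M W Zc Ph Qh where "X = xi u N"
    and "F = complex_of_real (wave_f e u)" and "a = complex_of_real (wave_v1 e u)"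
    and "b = complex_of_real (wave_v2 e u)" and "U = complex_of_real u" and "E = complex_of_real e"
    and "G = complex_of_real (wave_g \<kappa> e u)" and "M = mode_M e u N" and "W = mode_W e u N"
    and "Zc = mode_Z \<kappa> e u N" and "Ph = mode_P e u N" and "Qh = mode_Q e u N"
  note defs = X_def[symmetric] F_def[symmetric] a_def[symmetric] b_def[symmetric] U_def[symmetric]
    E_def[symmetric] G_def[symmetric] M_def[symmetric] W_def[symmetric] Zc_def[symmetric]
    Ph_def[symmetric] Qh_def[symmetric]
  define l where "l = E * W / (1 - U * Zc)"
  define q where "q = U * (F * E + G * a * l) / (1 - U\<^sup>2 * F * N)"
  have nz: "1 - U\<^sup>2 * F * N \<noteq> 0" "1 - U * Zc \<noteq> 0"
    using den Z by (simp_all add: defs)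
  have M: "M * (1 - U\<^sup>2 * F * N) = N"
    using den by (simp add: M_def mode_M_def defs)
  have W: "W = b + U\<^sup>2 * F * a * M"
    by (simp add: W_def mode_W_def defs)
  have Zc: "Zc = G * (a * Ph + E * b * X * Qh) + U * G * a\<^sup>2 * M"
    by (simp add: Zc_def mode_Z_def defs)
  have l: "l * (1 - U * Zc) = E * W"
    using nz by (simp add: l_def)
  have q: "q * (1 - U\<^sup>2 * F * N) = U * (F * E + G * a * l)"
    using nz by (simp add: q_def)
  \<comment> \<open>Writing N q through \<open>M\<close> removes the denominator, which leaves only
    polynomial identities below.\<close>
  have "N * q = (M * (1 - U\<^sup>2 * F * N)) * q"
    by (simp only: M)
  also have "\<dots> = M * (q * (1 - U\<^sup>2 * F * N))"
    by (simp only: ac_simps)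
  finally have Nq: "N * q = M * (U * (F * E + G * a * l))"
    by (simp only: q)
  have fp1: "N = F - E\<^sup>2 * (U\<^sup>2 * F\<^sup>2 * M + G * W\<^sup>2 / (1 - U * Zc))"
    using fp by (simp add: mode_Psi_def defs)
  have "E\<^sup>2 * (G * W\<^sup>2 / (1 - U * Zc)) = E * G * W * l"
    by (simp add: l_def power2_eq_square)
  then have fp2: "N = F - E\<^sup>2 * U\<^sup>2 * F\<^sup>2 * M - E * G * W * l"
    using fp1 by (simp add: algebra_simps)
  have PQ: "Ph * (X - U * F) = U * F * E * X * Qh + a" "- Qh * (1 - U * F * X) = U * F * E * Ph + E * b"
    using mode_PQ[OF det] by (simp_all add: defs)
  show ?thesis
  proof (rule that[of l q "U * G * l * Ph" "U * G * l * Qh"], unfold of_real_mult defs)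
    show "l = a * (U * N * q + U * G * l * Ph) + E * b * (1 + X * (U * G * l * Qh))"
      using Nq l W Zc by algebra
    show "q = U * F * (U * N * q + E) + U * G * a * l"
      using q by algebra
    show "- N = F * (E * U * N * q - 1) + G * E * b * l"
      using fp2 Nq W by algebra
    show "X * (U * G * l * Ph) = U * F * (U * G * l * Ph + E * (X * (U * G * l * Qh))) + U * G * a * l"
      using PQ(1) by algebra
    show "- (U * G * l * Qh) = U * F * (E * (U * G * l * Ph) - X * (U * G * l * Qh)) + U * G * E * b * l"
      using PQ(2) by algebra
  qed
qed

section \<open>Energies, decay rates and free solutions\<close>

lemma Im_two_divide: "Im (2 / w) = - (2 * Im w) / (cmod w)\<^sup>2"
  by (simp add: Im_divide cmod_power2)

text \<open>Write \<open>freq z\<close> as 2 / (1 + z^2) - 1; taking the reciprocal reverses the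
  sign of the imaginary part.\<close>

lemma Im_freq_neg:
  assumes "1 + z\<^sup>2 \<noteq> 0" "Im (z\<^sup>2) > 0"
  shows "Im (freq z) < 0"
proof -
  have "freq z = 2 / (1 + z\<^sup>2) - 1"
    using assms(1) by (simp add: freq_def field_simps)
  then have "Im (freq z) = - (2 * Im (z\<^sup>2)) / (cmod (1 + z\<^sup>2))\<^sup>2"
    using Im_two_divide[of "1 + z\<^sup>2"] by simp
  also have "\<dots> < 0"
    using assms by (intro divide_neg_pos) auto
  finally show ?thesis .
qed

text \<open>The radicand is 1 - 2 / (w + 1) and inherits the negative imaginary part of w, so its
  principal root c has Re c > 0 > Im c. Then both terms of - Im (c (w + 1)) are positive.\<close>

lemma Re_decay_pos:
  assumes "Im w < 0" "Re w > 0" "0 < Re ((w - 1) / (w + 1))"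
  shows "0 < Re (\<i> * csqrt ((w - 1) / (w + 1)) * (w + 1))"
proof -
  define X where "X = (w - 1) / (w + 1)"
  define c where "c = csqrt X"
  have w: "w + 1 \<noteq> 0"
    using assms(1) by (auto simp: complex_eq_iff)
  then have "X = 1 - 2 / (w + 1)"
    by (simp add: X_def field_simps)
  then have "Im X = 2 * Im w / (cmod (w + 1))\<^sup>2"
    using Im_two_divide[of "w + 1"] by simp
  also have "\<dots> < 0"
    using assms(1) w by (intro divide_neg_pos) auto
  finally have "Im X < 0" .
  moreover have "Im X = 2 * Re c * Im c"
    using Im_power2[of c] by (simp add: c_def)
  moreover have "Re c \<ge> 0"
    unfolding c_def using csqrt_principal[of X] by linarith
  ultimately have "Re c > 0" "Im c < 0"
    by (auto simp: mult_less_0_iff)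
  then have "Re c * Im w < 0" "Im c * (Re w + 1) < 0"
    using assms by (auto intro: mult_pos_neg mult_neg_pos)
  then show ?thesis
    unfolding X_def[symmetric] c_def[symmetric] by (simp add: algebra_simps)
qed

text \<open>A rational parametrization: for E = - m (1 - \<nu>^2) / (1 + \<nu>^2) the rate k = 2 m
  \<nu> / (1 + \<nu>^2) satisfies k^2 = m^2 - E^2, so this mode involves no choice of a
  root.\<close>

lemma dirac_exp_lower:
  assumes "1 + \<nu>\<^sup>2 \<noteq> 0"
  shows "dirac_exp m (- of_real m * freq \<nu>) (2 * of_real m * \<nu> / (1 + \<nu>\<^sup>2))
    (vector [\<nu> * q, 1]) (vector [\<nu>, q])"
  using assms unfolding dirac_exp_def freq_def vector_2
  by (simp add: divide_simps) (simp add: power2_eq_square algebra_simps)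

text \<open>Since X^2 (w + 1) = 1 - w, the rate k = m X (w + 1) satisfies k^2 = m^2 (1 - w^2)
  without a second root.\<close>

lemma dirac_exp_upper:
  assumes "w + 1 \<noteq> 0" "X = \<i> * csqrt ((w - 1) / (w + 1))"
  shows "dirac_exp m (of_real m * w) (of_real m * (X * (w + 1)))
    (vector [P, X * Q]) (vector [Q, X * P])"
proof -
  have "X * X = - ((w - 1) / (w + 1))"
    unfolding assms(2) by (simp add: power2_eq_square[symmetric] power_mult_distrib minus_divide_left)
  then have "X * X * (w + 1) = 1 - w"
    using assms(1) by (simp add: field_simps)
  then have X: "X * X * (w + 1) * c = (1 - w) * c" for c
    by simp
  show ?thesis
    unfolding dirac_exp_def vector_2 using X[of "of_real m * P"] X[of "of_real m * Q"]
    by (simp add: algebra_simps)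
qed

lemma linear_mode_exists:
  fixes \<alpha> :: real
  assumes m: "m > 0" and u: "u > 0" and adm: "admissible \<kappa> e u x y" and y: "y > 0"
    and N: "N = Complex x (u * y)"
    and fp: "N = of_real (wave_f e u) - of_real (e\<^sup>2) * mode_Psi \<kappa> e u N"
    and \<omega>: "of_real \<omega> = of_real m * freq (of_real u)"
    and g: "g * \<alpha>\<^sup>2 = 2 * u * wave_g \<kappa> e u"
  shows "\<exists>k A B k' A' B'. linear_mode m \<omega> e (2 * u * wave_f e u) g
    (vector [of_real (\<alpha> * wave_v1 e u), of_real (\<alpha> * e * wave_v2 e u)])
    (\<i> * (2 * of_real \<omega> + (of_real m * freq (of_real u * N) - of_real \<omega>))) k A B k' A' B'"
proof -
  define \<nu> where "\<nu> = of_real u * N"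
  define w where "w = upper_freq u N"
  have nz: "1 + \<nu>\<^sup>2 \<noteq> 0" "0 < Re (N / (1 + \<nu>\<^sup>2))" and w: "0 < Re w" "0 < Re ((w - 1) / (w + 1))" and x: "x > 0"
    using adm unfolding admissible_def Let_def by (auto simp: N \<nu>_def w_def)
  obtain q P Q l where sys:
    "l = of_real (wave_v1 e u) * (of_real u * N * q + P) + of_real (e * wave_v2 e u) * (1 + xi u N * Q)"
    "q = of_real (u * wave_f e u) * (of_real u * N * q + of_real e) + of_real (u * wave_g \<kappa> e u * wave_v1 e u) * l"
    "- N = of_real (wave_f e u) * (of_real (e * u) * N * q - 1) + of_real (wave_g \<kappa> e u * e * wave_v2 e u) * l"
    "xi u N * P = of_real (u * wave_f e u) * (P + of_real e * (xi u N * Q)) + of_real (u * wave_g \<kappa> e u * wave_v1 e u) * l"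
    "- Q = of_real (u * wave_f e u) * (of_real e * P - xi u N * Q) + of_real (u * wave_g \<kappa> e u * e * wave_v2 e u) * l"
    using mode_system[OF _ _ _ fp] adm unfolding admissible_def Let_def N[symmetric] by metis
  define X where "X = xi u N"
  \<comment> \<open>The second component of the mean of u is normalized to 1, which also makes the
    mode nontrivial.\<close>
  define A B A' B' :: spinor where "A = vector [\<nu> * q, 1]" and "B = vector [\<nu>, q]"
    and "A' = vector [P, X * Q]" and "B' = vector [Q, X * P]"
  define v :: spinor where "v = vector [of_real (\<alpha> * wave_v1 e u), of_real (\<alpha> * e * wave_v2 e u)]"
  have comps: "A $ 1 = \<nu> * q" "A $ 2 = 1" "B $ 1 = \<nu>" "B $ 2 = q"
    "A' $ 1 = P" "A' $ 2 = X * Q" "B' $ 1 = Q" "B' $ 2 = X * P"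
    "v $ 1 = of_real \<alpha> * of_real (wave_v1 e u)" "v $ 2 = of_real \<alpha> * of_real (e * wave_v2 e u)"
    by (simp_all add: A_def B_def A'_def B'_def v_def vector_2)
  have g': "of_real g * (of_real \<alpha>)\<^sup>2 = 2 * of_real u * (of_real (wave_g \<kappa> e u) :: complex)"
    using g by (metis of_real_mult of_real_numeral of_real_power)
  have L: "v $ 1 * (A $ 1 + A' $ 1) + v $ 2 * (A $ 2 + A' $ 2) = of_real \<alpha> * l"
    unfolding comps sys(1) \<nu>_def X_def by (simp add: algebra_simps)
  have L': "v $ 1 * (A' $ 1 + A $ 1) + v $ 2 * (A' $ 2 + A $ 2) = of_real \<alpha> * l"
    using L by (simp add: add.commute)
  have j1: "jump_condition e (2 * u * wave_f e u) g v A B A'"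
    unfolding jump_condition_def L unfolding comps \<nu>_def of_real_mult of_real_numeral
  proof (intro conjI, goal_cases)
    case 1
    show ?case using sys(2)[unfolded of_real_mult] g' by algebra
  next
    case 2
    show ?case using sys(3)[unfolded of_real_mult] g' by algebra
  qed
  have j2: "jump_condition e (2 * u * wave_f e u) g v A' B' A"
    unfolding jump_condition_def L' unfolding comps X_def of_real_mult of_real_numeral
  proof (intro conjI, goal_cases)
    case 1
    show ?case using sys(4)[unfolded of_real_mult] g' by algebra
  next
    case 2
    show ?case using sys(5)[unfolded of_real_mult] g' by algebra
  qed
  define z where "z = \<i> * (2 * of_real \<omega> + (of_real m * freq \<nu> - of_real \<omega>))"
  have iz: "\<i> * z = - (of_real \<omega> + of_real m * freq \<nu>)"
    unfolding z_def mult.assoc[symmetric] by simp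
  have wf: "w = 2 * freq (of_real u) + freq \<nu>"
    by (simp add: w_def upper_freq_def \<nu>_def)
  have E: "of_real \<omega> + \<i> * z = - of_real m * freq \<nu>" "of_real \<omega> - \<i> * z = of_real m * w"
    unfolding iz wf by (simp_all add: \<omega> algebra_simps)
  \<comment> \<open>Since \<open>freq (of_real u)\<close> is real, the sign comes from \<nu> alone,
    through y > 0.\<close>
  have "Im w < 0"
  proof -
    have "Im (\<nu>\<^sup>2) > 0"
      using u x y by (simp add: \<nu>_def N Im_power2)
    then have "Im (freq \<nu>) < 0"
      using nz(1) by (rule Im_freq_neg[rotated])
    moreover have "freq (of_real u) = of_real ((1 - u\<^sup>2) / (1 + u\<^sup>2))"
      by (simp add: freq_def)
    ultimately show ?thesis
      by (simp only: w_def upper_freq_def \<nu>_def) simp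
  qed
  then have "0 < Re (X * (w + 1))"
    unfolding X_def xi_def w_def[symmetric] using w by (intro Re_decay_pos)
  then have k': "0 < Re (of_real m * (X * (w + 1)))"
    using m by simp
  have Re_of_real_mult: "Re (of_real r * c) = r * Re c" for r c
    by simp
  have "2 * of_real m * \<nu> / (1 + \<nu>\<^sup>2) = of_real (2 * m * u) * (N / (1 + \<nu>\<^sup>2))"
    by (simp add: \<nu>_def)
  then have k: "0 < Re (2 * of_real m * \<nu> / (1 + \<nu>\<^sup>2))"
    using m u nz(2) by (simp only: Re_of_real_mult) simp
  have "w + 1 \<noteq> 0"
    using w(1) by (auto simp: complex_eq_iff)
  then have "linear_mode m \<omega> e (2 * u * wave_f e u) g v z
      (2 * of_real m * \<nu> / (1 + \<nu>\<^sup>2)) A B (of_real m * (X * (w + 1))) A' B'"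
    unfolding linear_mode_def E
    using k k' j1 j2 dirac_exp_lower[OF nz(1), of m q] dirac_exp_upper[of w X m P Q] comps(2)
    unfolding A_def[symmetric] B_def[symmetric] A'_def[symmetric] B'_def[symmetric]
    by (auto simp: X_def xi_def w_def)
  then show ?thesis
    unfolding v_def z_def \<nu>_def by blast
qed

section \<open>Instability\<close>

lemma mu_pos: "- m < \<omega> \<Longrightarrow> \<omega> < m \<Longrightarrow> 0 < mu m \<omega>"
  by (simp add: mu_def)

lemma freq_mu:
  assumes "- m < \<omega>" "\<omega> < m"
  shows "\<omega> = m * (1 - (mu m \<omega>)\<^sup>2) / (1 + (mu m \<omega>)\<^sup>2)"
proof -
  have "(mu m \<omega>)\<^sup>2 = (m - \<omega>) / (m + \<omega>)"
    using assms by (simp add: mu_def)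
  moreover have "m + \<omega> \<noteq> 0" "m \<noteq> 0"
    using assms by auto
  ultimately have "\<omega> * (1 + (mu m \<omega>)\<^sup>2) = m * (1 - (mu m \<omega>)\<^sup>2)"
    by (simp add: field_simps)
  moreover have "1 + (mu m \<omega>)\<^sup>2 \<noteq> 0"
    by (simp add: add_nonneg_eq_0_iff)
  ultimately show ?thesis
    by (metis nonzero_eq_divide_eq)
qed

lemma varkappa_mu:
  assumes "- m < \<omega>" "\<omega> < m"
  shows "varkappa m \<omega> = mu m \<omega> * (m + \<omega>)" and "varkappa m \<omega> * mu m \<omega> = m - \<omega>"
proof -
  have mu2: "(mu m \<omega>)\<^sup>2 = (m - \<omega>) / (m + \<omega>)"
    using assms by (simp add: mu_def)
  have "m\<^sup>2 - \<omega>\<^sup>2 = (mu m \<omega> * (m + \<omega>))\<^sup>2"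
    using assms unfolding power_mult_distrib mu2 by (simp add: field_simps power2_eq_square)
  then show *: "varkappa m \<omega> = mu m \<omega> * (m + \<omega>)"
    using assms mu_pos[OF assms] by (simp add: varkappa_def)
  have "mu m \<omega> * (m + \<omega>) * mu m \<omega> = (mu m \<omega>)\<^sup>2 * (m + \<omega>)"
    by (simp add: power2_eq_square)
  then show "varkappa m \<omega> * mu m \<omega> = m - \<omega>"
    using assms unfolding * mu2 by simp
qed

text \<open>Rationalizing the numerator: (1 + \<mu>^2 - s) (1 + \<mu>^2 + s) = 4 \<mu>^2 (1 + e^2),
  where s is the root. This cancels (1 + e^2) \<mu> and leaves a form that is regular at \<mu> =
  0.\<close>

lemma f_val_eq:
  assumes "mu m \<omega> > 0" and rad: "0 \<le> (1 - (mu m \<omega>)\<^sup>2)\<^sup>2 - 4 * (mu m \<omega>)\<^sup>2 * e\<^sup>2"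
  shows "f_val m \<omega> e = 2 * mu m \<omega> * wave_f e (mu m \<omega>)"
proof -
  define u where "u = mu m \<omega>"
  define s where "s = sqrt ((1 - u\<^sup>2)\<^sup>2 - 4 * u\<^sup>2 * e\<^sup>2)"
  have s: "s \<ge> 0" "s\<^sup>2 = (1 - u\<^sup>2)\<^sup>2 - 4 * u\<^sup>2 * e\<^sup>2"
    using rad by (auto simp: s_def u_def)
  have "1 - 2 * u\<^sup>2 + u^4 - 4 * u\<^sup>2 * e\<^sup>2 = (1 - u\<^sup>2)\<^sup>2 - 4 * u\<^sup>2 * e\<^sup>2"
    by (simp add: power2_diff)
  then have f: "f_val m \<omega> e = (1 + u\<^sup>2 - s) / ((1 + e\<^sup>2) * u)"
    by (simp add: f_val_def Let_def s_def u_def)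
  have pos: "1 + u\<^sup>2 + s > 0" "(1 + e\<^sup>2) * u > 0"
    using s(1) assms(1) by (auto intro!: add_pos_nonneg mult_pos_pos simp: u_def)
  have "(1 + u\<^sup>2 - s) * (1 + u\<^sup>2 + s) = 4 * u * ((1 + e\<^sup>2) * u)"
    using s(2) by algebra
  then have "(1 + u\<^sup>2 - s) / ((1 + e\<^sup>2) * u) = 4 * u / (1 + u\<^sup>2 + s)"
    using pos by (simp only: frac_eq_eq less_imp_neq[THEN not_sym] not_False_eq_True)
  then show ?thesis
    unfolding f by (simp add: wave_f_def s_def u_def)
qed

lemma powr_eq_iff_eq_powr_inverse:
  fixes t c \<kappa> :: real
  assumes "t > 0" "c > 0" "\<kappa> > 0"
  shows "t powr \<kappa> = c \<longleftrightarrow> t = c powr (1 / \<kappa>)"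
proof
  assume "t powr \<kappa> = c"
  then have "c powr (1 / \<kappa>) = t powr (\<kappa> * (1 / \<kappa>))"
    by (simp only: powr_powr[symmetric])
  then show "t = c powr (1 / \<kappa>)"
    using assms by simp
qed (use assms in \<open>simp add: powr_powr\<close>)

context
  fixes m \<omega> \<kappa> e :: real
  assumes \<omega>: "- m < \<omega>" "\<omega> < m" and \<kappa>: "\<kappa> > 0"
    and adm: "admissible \<kappa> e (mu m \<omega>) 1 0"
begin

private abbreviation (input) "u \<equiv> mu m \<omega>"

lemma wave_facts:
  shows "0 \<le> (1 - u\<^sup>2)\<^sup>2 - 4 * u\<^sup>2 * e\<^sup>2" "0 < wave_f e u" "u\<^sup>2 * wave_f e u < 1" "0 < wave_tau e u"
  using adm unfolding admissible_def Let_def by linarith+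

lemma wave_b_eq: "wave_b e u = wave_f e u + u\<^sup>2 * wave_f e u * wave_b e u"
  using wave_facts(3) by (simp add: wave_b_def field_simps)

text \<open>This identity and \<open>wave_b_eq\<close> are the two components of the jump condition
  for the profile, with common factors divided out.\<close>

lemma wave_f_eq: "wave_f e u * (1 - e\<^sup>2 * u\<^sup>2 * wave_b e u) = 1"
proof -
  have "(1 - u\<^sup>2 * wave_f e u) * (wave_f e u * (1 - e\<^sup>2 * u\<^sup>2 * wave_b e u)) = (1 - u\<^sup>2 * wave_f e u) * 1"
    using wave_f_quadratic[OF wave_facts(1)] wave_b_eq by algebra
  then show ?thesis
    using wave_facts(3) by (simp only: mult_cancel_left) simp
qed

text \<open>Because \<beta> is a multiple of \<alpha>, \<tau> is \<alpha>^2 times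
  \<open>wave_tau\<close>, and the implicit condition on f becomes a power equation for \<alpha>
  alone.\<close>

lemma amplitudes_iff:
  "amplitudes m \<kappa> \<omega> e \<alpha> \<beta> \<longleftrightarrow>
    \<alpha> > 0 \<and> \<alpha>\<^sup>2 * wave_tau e u = (2 * u * wave_f e u) powr (1 / \<kappa>) \<and> \<beta> = - (u * e * wave_b e u * \<alpha>)"
proof -
  have f: "f_val m \<omega> e = 2 * u * wave_f e u"
    by (rule f_val_eq[OF mu_pos[OF \<omega>] wave_facts(1)])
  have "- (f_val m \<omega> e * e * \<alpha>) / (2 - f_val m \<omega> e * u) = - (u * e * wave_b e u * \<alpha>)"
  proof -
    have "2 - f_val m \<omega> e * u = 2 * (1 - u\<^sup>2 * wave_f e u)"
      by (simp add: f power2_eq_square)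
    moreover have "- (2 * u * F * e * \<alpha>) / (2 * D) = - (u * e * (F / D) * \<alpha>)" for D F :: real
      by (cases "D = 0") (simp_all add: field_simps)
    ultimately show ?thesis
      unfolding wave_b_def by (simp only: f)
  qed
  moreover have "nonlin \<kappa> (\<alpha>\<^sup>2 * wave_tau e u) = f_val m \<omega> e \<longleftrightarrow>
      \<alpha>\<^sup>2 * wave_tau e u = (2 * u * wave_f e u) powr (1 / \<kappa>)" if "\<alpha> > 0"
  proof -
    have pos: "\<alpha>\<^sup>2 * wave_tau e u > 0" "2 * u * wave_f e u > 0"
      using that wave_facts mu_pos[OF \<omega>] by auto
    then show ?thesis
      using \<kappa> unfolding nonlin_def f by (simp only: abs_of_pos powr_eq_iff_eq_powr_inverse)
  qed
  moreover have "tau m \<omega> e \<alpha> (- (u * e * wave_b e u * \<alpha>)) = \<alpha>\<^sup>2 * wave_tau e u"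
    unfolding tau_def wave_tau_def by algebra
  ultimately show ?thesis
    unfolding amplitudes_def by auto
qed

lemma ex1_amplitudes: "\<exists>!p. amplitudes m \<kappa> \<omega> e (fst p) (snd p)"
proof -
  define c where "c = (2 * u * wave_f e u) powr (1 / \<kappa>) / wave_tau e u"
  have c: "c > 0"
    using wave_facts mu_pos[OF \<omega>] by (simp add: c_def)
  have iff: "amplitudes m \<kappa> \<omega> e \<alpha> \<beta> \<longleftrightarrow> \<alpha> = sqrt c \<and> \<beta> = - (u * e * wave_b e u * \<alpha>)" for \<alpha> \<beta>
  proof -
    have "\<alpha>\<^sup>2 * wave_tau e u = (2 * u * wave_f e u) powr (1 / \<kappa>) \<longleftrightarrow> \<alpha>\<^sup>2 = c"
      using wave_facts(4) by (simp add: c_def field_simps)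
    moreover have "\<alpha> > 0 \<and> \<alpha>\<^sup>2 = c \<longleftrightarrow> \<alpha> = sqrt c"
      using c by (auto intro: real_sqrt_unique[symmetric])
    ultimately show ?thesis
      unfolding amplitudes_iff by blast
  qed
  show ?thesis
    unfolding iff by (rule ex1I[of _ "(sqrt c, - (u * e * wave_b e u * sqrt c))"]) auto
qed

context
  fixes \<alpha> \<beta> :: real
  assumes amp: "amplitudes m \<kappa> \<omega> e \<alpha> \<beta>"
begin

lemma amplitude_facts:
  shows "\<alpha> > 0" "\<beta> = - (u * e * wave_b e u * \<alpha>)" "tau m \<omega> e \<alpha> \<beta> = \<alpha>\<^sup>2 * wave_tau e u"
    "nonlin \<kappa> (tau m \<omega> e \<alpha> \<beta>) = 2 * u * wave_f e u"
proof -
  show a: "\<alpha> > 0" "\<beta> = - (u * e * wave_b e u * \<alpha>)"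
    using amp unfolding amplitudes_iff by blast+
  show "tau m \<omega> e \<alpha> \<beta> = \<alpha>\<^sup>2 * wave_tau e u"
    unfolding tau_def wave_tau_def a(2) by algebra
  show "nonlin \<kappa> (tau m \<omega> e \<alpha> \<beta>) = 2 * u * wave_f e u"
    by (rule trans[OF conjunct1[OF conjunct2[OF amp[unfolded amplitudes_def]]]
        f_val_eq[OF mu_pos[OF \<omega>] wave_facts(1)]])
qed

lemma solitary_wave_profile: "solitary_wave m \<kappa> e \<omega> (profile m \<omega> \<alpha> \<beta>)"
proof -
  define A B :: spinor where "A = vector [of_real \<alpha>, of_real (\<beta> * u)]" and "B = vector [of_real \<beta>, of_real (\<alpha> * u)]"
  have form: "coupling_form e A = tau m \<omega> e \<alpha> \<beta>"
    by (simp add: coupling_form_def sum_2 coupling_component A_def vector_2 tau_def power2_eq_square algebra_simps)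
  have k: "Re (of_real (varkappa m \<omega>)) > 0"
    using \<omega> mu_pos[OF \<omega>] by (simp add: varkappa_mu(1))
  have eq: "dirac_exp m (of_real \<omega>) (of_real (varkappa m \<omega>)) A B"
  proof -
    define k where "k = varkappa m \<omega>"
    have kk: "k = u * (m + \<omega>)" "k * u = m - \<omega>"
      using varkappa_mu[OF \<omega>] by (simp_all add: k_def)
    have "- k * (\<alpha> * u) + m * \<alpha> = \<omega> * \<alpha>" "k * \<beta> - m * (\<beta> * u) = \<omega> * (\<beta> * u)"
      "- k * (\<beta> * u) + m * \<beta> = \<omega> * \<beta>" "k * \<alpha> - m * (\<alpha> * u) = \<omega> * (\<alpha> * u)"
      using kk by algebra+
    then show ?thesis
      unfolding dirac_exp_def A_def B_def vector_2 k_def[symmetric]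
      by (simp only: of_real_mult[symmetric] of_real_minus[symmetric] of_real_add[symmetric] of_real_diff[symmetric] simp_thms)
  qed
  have "2 * (\<alpha> * u) = 2 * u * wave_f e u * (\<alpha> + e * (\<beta> * u))"
  proof -
    have "\<alpha> + e * (\<beta> * u) = \<alpha> * (1 - e\<^sup>2 * u\<^sup>2 * wave_b e u)"
      unfolding amplitude_facts(2) by (simp add: algebra_simps power2_eq_square)
    then have "2 * u * wave_f e u * (\<alpha> + e * (\<beta> * u)) =
        2 * u * \<alpha> * (wave_f e u * (1 - e\<^sup>2 * u\<^sup>2 * wave_b e u))"
      by (simp only: ac_simps)
    then show ?thesis
      unfolding wave_f_eq by (simp only: mult_1_right ac_simps)
  qed
  moreover have "- 2 * \<beta> = 2 * u * wave_f e u * (e * \<alpha> - \<beta> * u)"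
  proof -
    have "2 * u * wave_f e u * (e * \<alpha> - \<beta> * u) =
        2 * u * e * \<alpha> * (wave_f e u + u\<^sup>2 * wave_f e u * wave_b e u)"
      unfolding amplitude_facts(2) by (simp add: algebra_simps power2_eq_square)
    also have "\<dots> = - 2 * \<beta>"
      unfolding wave_b_eq[symmetric] amplitude_facts(2) by simp
    finally show ?thesis
      by (rule sym)
  qed
  ultimately have jump: "complex_of_real (2 * (\<alpha> * u)) = of_real (2 * u * wave_f e u * (\<alpha> + e * (\<beta> * u)))"
      "complex_of_real (- 2 * \<beta>) = of_real (2 * u * wave_f e u * (e * \<alpha> - \<beta> * u))"
    by (simp_all only:)
  have "2 * B $ 2 = nonlin \<kappa> (coupling_form e A) * (A $ 1 + e * A $ 2)"
      "- 2 * B $ 1 = nonlin \<kappa> (coupling_form e A) * (e * A $ 1 - A $ 2)"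
    unfolding form amplitude_facts(4) unfolding A_def B_def vector_2 using jump
    by (simp_all only: of_real_mult of_real_minus of_real_add of_real_diff of_real_numeral)
  then show ?thesis
    unfolding profile_eq_two_sided_exp A_def[symmetric] B_def[symmetric]
    using k eq by (intro solitary_wave_two_sided_exp)
qed

lemma eigenvalues:
  assumes "m > 0" and adm_xy: "admissible \<kappa> e u x y" and y: "y > 0"
    and N: "N = Complex x (u * y)"
    and fp: "N = of_real (wave_f e u) - of_real (e\<^sup>2) * mode_Psi \<kappa> e u N"
    and z: "z = \<i> * (2 * of_real \<omega> + (of_real m * freq (of_real u * N) - of_real \<omega>))"
  shows "{z, - z, cnj z, - cnj z} \<subseteq> point_spectrum (linearization m \<kappa> \<omega> e \<alpha> \<beta>)"
proof -
  define \<tau> where "\<tau> = tau m \<omega> e \<alpha> \<beta>"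
  define v where "v = lin_vec m \<omega> e \<alpha> \<beta>"
  have \<tau>: "\<tau> = \<alpha>\<^sup>2 * wave_tau e u" "\<tau> > 0"
    using amplitude_facts wave_facts by (auto simp: \<tau>_def)
  \<comment> \<open>Near the positive number \<tau> the nonlinearity is a pure power, so \<tau>
    f'(\<tau>) = \<kappa> f(\<tau>). This yields g \<alpha>^2 = 2 \<mu>
    \<open>wave_g\<close>.\<close>
  have "((\<lambda>t. t powr \<kappa>) has_real_derivative \<kappa> * \<tau> powr (\<kappa> - 1)) (at \<tau>)"
    by (rule has_real_derivative_powr[OF \<tau>(2)])
  then have "(nonlin \<kappa> has_real_derivative \<kappa> * \<tau> powr (\<kappa> - 1)) (at \<tau>)"
    by (rule has_field_derivative_transform_within_open[of _ _ _ "{0<..}"]) (use \<tau>(2) in \<open>auto simp: nonlin_def\<close>)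
  then have "deriv (nonlin \<kappa>) \<tau> = \<kappa> * \<tau> powr (\<kappa> - 1)"
    by (rule DERIV_imp_deriv)
  also have "\<dots> = \<kappa> * (nonlin \<kappa> \<tau> / \<tau>)"
    using \<tau>(2) by (simp add: nonlin_def powr_diff)
  also have "nonlin \<kappa> \<tau> = 2 * u * wave_f e u"
    using amplitude_facts(4) by (simp add: \<tau>_def)
  finally have g: "deriv (nonlin \<kappa>) \<tau> * \<alpha>\<^sup>2 = 2 * u * wave_g \<kappa> e u"
    using amplitude_facts(1) wave_facts(4) by (simp add: \<tau>(1) wave_g_def)
  have v: "v = vector [of_real (\<alpha> * wave_v1 e u), of_real (\<alpha> * e * wave_v2 e u)]"
  proof -
    have "\<alpha> + e * \<beta> * u = \<alpha> * wave_v1 e u" "e * \<alpha> - \<beta> * u = \<alpha> * e * wave_v2 e u"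
      unfolding amplitude_facts(2) wave_v1_def wave_v2_def by algebra+
    then show ?thesis
      by (simp only: v_def lin_vec_def)
  qed
  have cnj_v: "cnj_vec v = v"
    by (simp add: v vec2_eq_iff vector_2)
  have \<omega>_freq: "of_real \<omega> = of_real m * freq (of_real u)"
    by (subst freq_mu[OF \<omega>]) (simp add: freq_def)
  obtain k A B k' A' B' where mode:
      "linear_mode m \<omega> e (nonlin \<kappa> \<tau>) (deriv (nonlin \<kappa>) \<tau>) v z k A B k' A' B'"
    using linear_mode_exists[OF \<open>m > 0\<close> mu_pos[OF \<omega>] adm_xy y N fp \<omega>_freq g]
    unfolding z v \<tau>_def amplitude_facts(4) by blast
  note spec = linear_mode_imp_point_spectrum[OF \<tau>_def, folded v_def]
  \<comment> \<open>The two symmetries of the modes produce the whole quadruple from one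
    mode.\<close>
  show ?thesis
    using spec[OF mode] spec[OF linear_mode_uminus[OF mode]] spec[OF linear_mode_cnj[OF mode cnj_v]]
      spec[OF linear_mode_uminus[OF linear_mode_cnj[OF mode cnj_v]]]
    by simp
qed

end

end

section \<open>Spectral instability for frequencies near m\<close>

lemma linearization_unstable:
  assumes "z \<in> point_spectrum (linearization m \<kappa> \<omega> \<epsilon> \<alpha> \<beta>)" "Re z > 0"
  shows "\<not> spectrally_stable (linearization m \<kappa> \<omega> \<epsilon> \<alpha> \<beta>)"
  using point_spectrum_subset_spectrum[of "linearization m \<kappa> \<omega> \<epsilon> \<alpha> \<beta>"] assms
  unfolding spectrally_stable_def by blast

theorem theorem5p1:
  fixes m \<kappa> :: real
  assumes "m > 0" and "\<kappa> > 0"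
  shows "\<exists>\<omega>\<^sub>0 U. - m < \<omega>\<^sub>0 \<and> \<omega>\<^sub>0 < m \<and> open U \<and> (0::real) \<in> U \<and>
    (\<forall>\<omega>. \<omega>\<^sub>0 < \<omega> \<and> \<omega> < m \<longrightarrow>
      (\<forall>\<epsilon>\<in>U. (\<exists>!p. amplitudes m \<kappa> \<omega> \<epsilon> (fst p) (snd p)) \<and>
        (\<forall>\<alpha> \<beta>. amplitudes m \<kappa> \<omega> \<epsilon> \<alpha> \<beta> \<longrightarrow>
          solitary_wave m \<kappa> \<epsilon> \<omega> (profile m \<omega> \<alpha> \<beta>))) \<and>
      (\<exists>\<zeta> :: real \<Rightarrow> complex. (\<zeta> \<longlongrightarrow> 0) (at 0) \<and>
        (\<forall>\<epsilon>\<in>U - {0}. Im (\<zeta> \<epsilon>) < 0 \<and>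
          (\<forall>\<alpha> \<beta>. amplitudes m \<kappa> \<omega> \<epsilon> \<alpha> \<beta> \<longrightarrow>
            (let A = linearization m \<kappa> \<omega> \<epsilon> \<alpha> \<beta>; z = \<i> * (2 * of_real \<omega> + \<zeta> \<epsilon>) in
              {z, - z, cnj z, - cnj z} \<subseteq> point_spectrum A \<and>
              \<not> spectrally_stable A)))))"
proof -
  obtain \<delta> where \<delta>: "0 < \<delta>" "\<delta> < 1"
    "\<And>e u x y. \<bar>e\<bar> \<le> \<delta> \<Longrightarrow> \<bar>u\<bar> \<le> \<delta> \<Longrightarrow> \<bar>x - 1\<bar> \<le> \<delta> \<Longrightarrow> \<bar>y\<bar> \<le> \<delta> \<Longrightarrow> admissible \<kappa> e u x y"
    using ex_admissible_box[OF assms(2)] by blast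
  \<comment> \<open>The denominator is the sum of 2 \<kappa>^2 and \<kappa> + 2 and exceeds 1. Then
    |e| \<le> r \<le> \<delta> < 1 gives e^2 \<le> r, and both smallness conditions of
    \<open>ex_fixed_point\<close> follow.\<close>
  define r where "r = \<delta> / (2 * \<kappa>\<^sup>2 + \<kappa> + 2)"
  define U where "U = {- r<..<r}"
  have den: "2 * \<kappa>\<^sup>2 + \<kappa> + 2 > 1"
    using assms(2) by (simp add: add_pos_pos add_nonneg_pos)
  have "\<delta> / (2 * \<kappa>\<^sup>2 + \<kappa> + 2) \<le> \<delta> / 1"
    using \<delta>(1) den by (intro divide_left_mono) auto
  then have r: "r > 0" "r \<le> \<delta>"
    using \<delta>(1) den by (auto simp: r_def)
  have U: "\<bar>e\<bar> \<le> \<delta>" "e\<^sup>2 * (\<kappa> + 2) \<le> \<delta>" "e\<^sup>2 * (2 * \<kappa>\<^sup>2) \<le> \<delta>" if "e \<in> U" for e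
  proof -
    have "\<bar>e\<bar> \<le> r"
      using that by (auto simp: U_def)
    then show "\<bar>e\<bar> \<le> \<delta>"
      using r(2) by simp
    have "e\<^sup>2 \<le> r"
    proof -
      have "\<bar>e\<bar> * \<bar>e\<bar> \<le> r * 1"
        using \<open>\<bar>e\<bar> \<le> r\<close> r(2) \<delta>(2) by (intro mult_mono) auto
      then show ?thesis
        by (simp add: power2_eq_square)
    qed
    then have *: "e\<^sup>2 * (2 * \<kappa>\<^sup>2 + \<kappa> + 2) \<le> \<delta>"
      using den by (simp add: r_def pos_le_divide_eq)
    have "e\<^sup>2 * (\<kappa> + 2) \<le> e\<^sup>2 * (2 * \<kappa>\<^sup>2 + \<kappa> + 2)" "e\<^sup>2 * (2 * \<kappa>\<^sup>2) \<le> e\<^sup>2 * (2 * \<kappa>\<^sup>2 + \<kappa> + 2)"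
      using assms(2) by (intro mult_left_mono; simp)+
    with * show "e\<^sup>2 * (\<kappa> + 2) \<le> \<delta>" "e\<^sup>2 * (2 * \<kappa>\<^sup>2) \<le> \<delta>"
      by linarith+
  qed
  \<comment> \<open>Beyond this frequency, \<mu>^2 = (m - \<omega>) / (m + \<omega>) is at most (m -
    \<omega>) / m, which is below \<delta>^2.\<close>
  define \<omega>\<^sub>0 where "\<omega>\<^sub>0 = m * (1 - \<delta>\<^sup>2)"
  have \<delta>2: "\<delta>\<^sup>2 < 1"
    using \<delta> by (simp add: power_less_one_iff)
  then have "\<omega>\<^sub>0 > 0" "\<omega>\<^sub>0 < m"
    using assms(1) \<delta>(1) by (simp_all add: \<omega>\<^sub>0_def)
  have wave: "(\<forall>\<epsilon>\<in>U. (\<exists>!p. amplitudes m \<kappa> \<omega> \<epsilon> (fst p) (snd p)) \<and>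
        (\<forall>\<alpha> \<beta>. amplitudes m \<kappa> \<omega> \<epsilon> \<alpha> \<beta> \<longrightarrow>
          solitary_wave m \<kappa> \<epsilon> \<omega> (profile m \<omega> \<alpha> \<beta>))) \<and>
      (\<exists>\<zeta> :: real \<Rightarrow> complex. (\<zeta> \<longlongrightarrow> 0) (at 0) \<and>
        (\<forall>\<epsilon>\<in>U - {0}. Im (\<zeta> \<epsilon>) < 0 \<and>
          (\<forall>\<alpha> \<beta>. amplitudes m \<kappa> \<omega> \<epsilon> \<alpha> \<beta> \<longrightarrow>
            (let A = linearization m \<kappa> \<omega> \<epsilon> \<alpha> \<beta>; z = \<i> * (2 * of_real \<omega> + \<zeta> \<epsilon>) in
              {z, - z, cnj z, - cnj z} \<subseteq> point_spectrum A \<and>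
              \<not> spectrally_stable A))))" if "\<omega>\<^sub>0 < \<omega>" "\<omega> < m" for \<omega>
  proof -
    have \<omega>: "- m < \<omega>" "\<omega> < m" "\<omega> > 0"
      using that \<open>\<omega>\<^sub>0 > 0\<close> assms(1) by linarith+
    define u where "u = mu m \<omega>"
    have "u > 0"
      using mu_pos \<omega> by (simp add: u_def)
    have "u\<^sup>2 \<le> \<delta>\<^sup>2"
    proof -
      have "u\<^sup>2 = (m - \<omega>) / (m + \<omega>)"
        using \<omega> by (simp add: u_def mu_def)
      also have "\<dots> \<le> (m - \<omega>) / m"
        using \<omega> assms(1) by (intro divide_left_mono) auto
      also have "\<dots> \<le> \<delta>\<^sup>2"
        using that(1) assms(1) by (simp add: \<omega>\<^sub>0_def field_simps)
      finally show ?thesis .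
    qed
    then have u: "\<bar>u\<bar> \<le> \<delta>"
      using \<delta>(1) \<open>u > 0\<close> power2_le_imp_le[of u \<delta>] by simp
    have adm: "admissible \<kappa> e (mu m \<omega>) 1 0" if "e \<in> U" for e
      using \<delta>(3)[OF U(1)[OF that] u, of 1 0] \<delta>(1) by (simp add: u_def)
    have "\<forall>e\<in>U. \<exists>p. admissible \<kappa> e u (fst p) (snd p) \<and> (e \<noteq> 0 \<longrightarrow> snd p > 0) \<and>
        cmod (Complex (fst p) (u * snd p) - 1) \<le> e\<^sup>2 * (\<kappa> + 2) \<and>
        Complex (fst p) (u * snd p) = of_real (wave_f e u) - of_real (e\<^sup>2) * mode_Psi \<kappa> e u (Complex (fst p) (u * snd p))"
    proof
      fix e assume e: "e \<in> U"
      show "\<exists>p. admissible \<kappa> e u (fst p) (snd p) \<and> (e \<noteq> 0 \<longrightarrow> snd p > 0) \<and>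
        cmod (Complex (fst p) (u * snd p) - 1) \<le> e\<^sup>2 * (\<kappa> + 2) \<and>
        Complex (fst p) (u * snd p) = of_real (wave_f e u) - of_real (e\<^sup>2) * mode_Psi \<kappa> e u (Complex (fst p) (u * snd p))"
        unfolding split_paired_Ex fst_conv snd_conv
        by (rule ex_fixed_point[OF \<delta>(1) _ \<open>u > 0\<close>]) (use \<delta>(3) U[OF e] u in auto)
    qed
    then obtain p where p: "\<And>e. e \<in> U \<Longrightarrow> admissible \<kappa> e u (fst (p e)) (snd (p e))"
        "\<And>e. e \<in> U \<Longrightarrow> e \<noteq> 0 \<Longrightarrow> snd (p e) > 0"
        "\<And>e. e \<in> U \<Longrightarrow> cmod (Complex (fst (p e)) (u * snd (p e)) - 1) \<le> e\<^sup>2 * (\<kappa> + 2)"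
        "\<And>e. e \<in> U \<Longrightarrow> Complex (fst (p e)) (u * snd (p e)) = of_real (wave_f e u)
          - of_real (e\<^sup>2) * mode_Psi \<kappa> e u (Complex (fst (p e)) (u * snd (p e)))"
      by metis
    \<comment> \<open>The fixed points are chosen separately for each \<open>e\<close>, and
      continuity in \<open>e\<close> is not asserted. The bound |N - 1| \<le> e^2 (\<kappa> + 2)
      alone gives the limit at 0.\<close>
    define N where "N = (\<lambda>e. Complex (fst (p e)) (u * snd (p e)))"
    define \<zeta> where "\<zeta> = (\<lambda>e. of_real m * freq (of_real u * N e) - of_real \<omega>)"
    have \<omega>_freq: "of_real \<omega> = of_real m * freq (of_real u)"
      by (subst freq_mu[OF \<omega>(1,2)]) (simp add: freq_def u_def)
    have "eventually (\<lambda>e. e \<in> U) (at 0)"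
      using r(1) by (intro eventually_at_in_open') (auto simp: U_def)
    then have "eventually (\<lambda>e. norm (N e - 1) \<le> e\<^sup>2 * (\<kappa> + 2)) (at 0)"
      by eventually_elim (use p(3) in \<open>simp add: N_def\<close>)
    moreover have "((\<lambda>e::real. e\<^sup>2 * (\<kappa> + 2)) \<longlongrightarrow> 0) (at 0)"
      by (auto intro!: tendsto_eq_intros)
    ultimately have "((\<lambda>e. N e - 1) \<longlongrightarrow> 0) (at 0)"
      by (rule Lim_null_comparison)
    then have N: "(N \<longlongrightarrow> 1) (at 0)"
      by (simp add: LIM_zero_iff)
    have "1 + (complex_of_real u)\<^sup>2 \<noteq> 0"
    proof -
      have "1 + u\<^sup>2 \<noteq> 0"
        by (simp add: add_nonneg_eq_0_iff)
      then show ?thesis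
        by (metis of_real_1 of_real_add of_real_eq_0_iff of_real_power)
    qed
    then have "(\<zeta> \<longlongrightarrow> of_real m * freq (of_real u * 1) - of_real \<omega>) (at 0)"
      unfolding \<zeta>_def freq_def by (intro tendsto_intros N) simp
    then have lim: "(\<zeta> \<longlongrightarrow> 0) (at 0)"
      by (simp add: \<omega>_freq)
    have Im: "Im (\<zeta> e) < 0" if e: "e \<in> U" "e \<noteq> 0" for e
    proof -
      have "1 + (of_real u * N e)\<^sup>2 \<noteq> 0" "fst (p e) > 0"
        using p(1)[OF e(1)] unfolding admissible_def Let_def N_def by blast+
      moreover have "Im ((of_real u * N e)\<^sup>2) > 0"
        using calculation(2) p(2)[OF e] \<open>u > 0\<close> by (simp add: N_def Im_power2)
      ultimately have "Im (freq (of_real u * N e)) < 0"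
        by (intro Im_freq_neg)
      then show ?thesis
        using assms(1) by (simp add: \<zeta>_def mult_pos_neg)
    qed
    have spec: "{z, - z, cnj z, - cnj z} \<subseteq> point_spectrum (linearization m \<kappa> \<omega> e \<alpha> \<beta>) \<and>
        \<not> spectrally_stable (linearization m \<kappa> \<omega> e \<alpha> \<beta>)"
      if e: "e \<in> U" "e \<noteq> 0" and amp: "amplitudes m \<kappa> \<omega> e \<alpha> \<beta>" and z: "z = \<i> * (2 * of_real \<omega> + \<zeta> e)" for e \<alpha> \<beta> z
    proof -
      have "{z, - z, cnj z, - cnj z} \<subseteq> point_spectrum (linearization m \<kappa> \<omega> e \<alpha> \<beta>)"
        by (rule eigenvalues[OF \<omega>(1,2) assms(2) adm[OF e(1)] amp assms(1) p(1)[OF e(1), unfolded u_def] p(2)[OF e]])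
          (use p(4)[OF e(1)] in \<open>auto simp: z \<zeta>_def N_def u_def\<close>)
      \<comment> \<open>As \<omega> is real, Re z is - Im \<zeta>.\<close>
      moreover have "Re z > 0"
        using Im[OF e] by (simp add: z)
      ultimately show ?thesis
        using linearization_unstable by blast
    qed
    have wave: "(\<exists>!p. amplitudes m \<kappa> \<omega> e (fst p) (snd p)) \<and>
        (\<forall>\<alpha> \<beta>. amplitudes m \<kappa> \<omega> e \<alpha> \<beta> \<longrightarrow> solitary_wave m \<kappa> e \<omega> (profile m \<omega> \<alpha> \<beta>))" if "e \<in> U" for e
      using ex1_amplitudes[OF \<omega>(1,2) assms(2) adm[OF that]]
        solitary_wave_profile[OF \<omega>(1,2) assms(2) adm[OF that]] by blast
    have "Im (\<zeta> e) < 0 \<and> (\<forall>\<alpha> \<beta>. amplitudes m \<kappa> \<omega> e \<alpha> \<beta> \<longrightarrow>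
        (let A = linearization m \<kappa> \<omega> e \<alpha> \<beta>; z = \<i> * (2 * of_real \<omega> + \<zeta> e) in
          {z, - z, cnj z, - cnj z} \<subseteq> point_spectrum A \<and> \<not> spectrally_stable A))" if "e \<in> U - {0}" for e
      unfolding Let_def
    proof (intro conjI[OF Im] allI impI)
      show "e \<in> U" "e \<noteq> 0"
        using that by auto
      then show "{\<i> * (2 * of_real \<omega> + \<zeta> e), - (\<i> * (2 * of_real \<omega> + \<zeta> e)),
            cnj (\<i> * (2 * of_real \<omega> + \<zeta> e)), - cnj (\<i> * (2 * of_real \<omega> + \<zeta> e))}
          \<subseteq> point_spectrum (linearization m \<kappa> \<omega> e \<alpha> \<beta>) \<and>
          \<not> spectrally_stable (linearization m \<kappa> \<omega> e \<alpha> \<beta>)" if "amplitudes m \<kappa> \<omega> e \<alpha> \<beta>" for \<alpha> \<beta>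
        using that by (intro spec refl)
    qed
    note inst = this
    show ?thesis
    proof (rule conjI)
      show "\<exists>\<zeta> :: real \<Rightarrow> complex. (\<zeta> \<longlongrightarrow> 0) (at 0) \<and>
        (\<forall>\<epsilon>\<in>U - {0}. Im (\<zeta> \<epsilon>) < 0 \<and>
          (\<forall>\<alpha> \<beta>. amplitudes m \<kappa> \<omega> \<epsilon> \<alpha> \<beta> \<longrightarrow>
            (let A = linearization m \<kappa> \<omega> \<epsilon> \<alpha> \<beta>; z = \<i> * (2 * of_real \<omega> + \<zeta> \<epsilon>) in
              {z, - z, cnj z, - cnj z} \<subseteq> point_spectrum A \<and> \<not> spectrally_stable A)))"
        by (rule exI[of _ \<zeta>], rule conjI[OF lim], rule ballI, erule inst)
    qed (rule ballI, erule wave)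
  qed
  show ?thesis
  proof (rule exI[of _ \<omega>\<^sub>0], rule exI[of _ U], intro conjI)
    show "- m < \<omega>\<^sub>0" "\<omega>\<^sub>0 < m" "open U" "0 \<in> U"
      using \<open>\<omega>\<^sub>0 > 0\<close> \<open>\<omega>\<^sub>0 < m\<close> assms(1) r(1) by (simp_all add: U_def)
  qed (rule allI, rule impI, erule conjE, erule (1) wave)
qed

end
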